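(* Let $R_1,R_2>0$, $R>R_1+R_2$ and $T>0$. Let $f\in L^2(B_R)$ be real-valued, not identically zero (as an $L^2$ function), compactly supported in $B_{R_1}$ and extended by zero to $\mathbb R^3$. Let $g:[0,\infty)\to\mathbb R$ be continuous and bounded with $g(t)>0$ for all $t\in(0,T)$. Let $a=(a_1,a_2,a_3)$ and $b=(b_1,b_2,b_3)$ be two orbit functions in $C^1([0,\infty);\mathbb R^3)$ with $|a(t)|<R_2$ and $|b(t)|<R_2$ for all $t\ge0$, such that $a(0)=b(0)=0$ and, for each $j=1,2,3$, $a_j'(t)\neq0$ and $b_j'(t)\neq 0$ for all $t\in(0,T)$. Let $u_1$ and $u_2$ be the solutions of $$\partial_t u_1-\Delta u_1=f(x-a(t))\,g(t),\qquad \partial_t u_2-\Delta u_2=f(x-b(t))\,g(t)\qquad\text{in }\mathbb R^3\times(0,\infty),$$ with $u_1(x,0)=u_2(x,0)=0$ for $x\in\mathbb R^3$. If $u_1(x,T)=u_2(x,T)$ for all $x\in B_R$, then $a(t)=b(t)$ for all $t\in[0,T]$.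
   Context: $B_\rho\subset\mathbb R^3$ denotes the open ball of radius $\rho$ centered at the origin. "The solution" of the initial value problem $\partial_t u-\Delta u=f(x-a(t))g(t)$, $u(\cdot,0)=0$, is the unique solution with $u\in L^2(0,T';H^2(\mathbb R^3))$ for every $T'>0$; it is given by Duhamel's formula $$u(x,t)=\int_0^t\int_{\mathbb R^3}G(x-y,t-s)\,f(y-a(s))\,g(s)\,dy\,ds,\qquad G(x,t)=\frac{1}{(4\pi t)^{3/2}}e^{-|x|^2/(4t)},$$ and the pointwise values $u(x,T)$ are understood via this formula. *)

theory Defs
  imports "HOL-Analysis.Analysis"
begin

text \<open>Representatives of elements of \<open>L\<^sup>2(S)\<close>, with respect to Lebesgue measure.\<close>

definition square_integrable_on :: "('a::euclidean_space \<Rightarrow> real) \<Rightarrow> 'a set \<Rightarrow> bool"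
    (infixr "square'_integrable'_on" 46) where
  "v square_integrable_on S \<longleftrightarrow>
     v \<in> borel_measurable (lebesgue_on S) \<and> integrable (lebesgue_on S) (\<lambda>x. (v x)\<^sup>2)"

primrec Ck :: "nat \<Rightarrow> ('a::euclidean_space \<Rightarrow> real) \<Rightarrow> bool" where
  "Ck 0 \<phi> = continuous_on UNIV \<phi>"
| "Ck (Suc k) \<phi> =
     (\<exists>D. (\<forall>x. (\<phi> has_derivative D x) (at x)) \<and> (\<forall>i\<in>Basis. Ck k (\<lambda>x. D x i)))"

text \<open>\<open>C\<^sub>c\<^sup>\<infinity>(\<Omega>)\<close>, extended by zero to the whole space.\<close>

definition test_function :: "'a::euclidean_space set \<Rightarrow> ('a \<Rightarrow> real) \<Rightarrow> bool" where
  "test_function \<Omega> \<phi> \<longleftrightarrow>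
     (\<forall>k. Ck k \<phi>) \<and> compact (closure {x. \<phi> x \<noteq> 0}) \<and> closure {x. \<phi> x \<noteq> 0} \<subseteq> \<Omega>"

text \<open>
  \<open>w\<close> is the weak derivative of \<open>v\<close> in \<open>\<Omega>\<close> in the direction \<open>e\<close>. Local integrability of
  \<open>v\<close> and \<open>w\<close> is not part of the definition; below it always follows from square integrability.
\<close>

definition weak_derivative ::
    "'a::euclidean_space set \<Rightarrow> 'a \<Rightarrow> ('a \<Rightarrow> real) \<Rightarrow> ('a \<Rightarrow> real) \<Rightarrow> bool" where
  "weak_derivative \<Omega> e v w \<longleftrightarrow>
     (\<forall>\<phi>. test_function \<Omega> \<phi> \<longrightarrow>
        (LINT x|lebesgue_on \<Omega>. v x * frechet_derivative \<phi> (at x) e)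
          = - (LINT x|lebesgue_on \<Omega>. w x * \<phi> x))"

text \<open>\<open>v \<in> H\<^sup>2(\<real>\<^sup>3)\<close> with first and second weak derivatives \<open>p i\<close> and \<open>q i j\<close>.\<close>

definition H2_with_derivatives ::
    "(real^3 \<Rightarrow> real) \<Rightarrow> (3 \<Rightarrow> real^3 \<Rightarrow> real) \<Rightarrow> (3 \<Rightarrow> 3 \<Rightarrow> real^3 \<Rightarrow> real) \<Rightarrow> bool" where
  "H2_with_derivatives v p q \<longleftrightarrow>
     v square_integrable_on UNIV \<and>
     (\<forall>i. p i square_integrable_on UNIV \<and> weak_derivative UNIV (axis i 1) v (p i)) \<and>
     (\<forall>i j. q i j square_integrable_on UNIV \<and> weak_derivative UNIV (axis j 1) (p i) (q i j))"

text \<open>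
  \<open>u \<in> L\<^sup>2(0,T';H\<^sup>2(\<real>\<^sup>3))\<close> for every \<open>T' > 0\<close>, where \<open>p i\<close> and \<open>q i j\<close> are the first and second
  weak derivatives of \<open>u\<close> in space: almost every time slice is in \<open>H\<^sup>2\<close>, and the squared \<open>H\<^sup>2\<close>
  norm is integrable over \<open>(0,T')\<close>, which by Tonelli is the square integrability of \<open>u\<close>,
  \<open>p i\<close>, \<open>q i j\<close> over \<open>\<real>\<^sup>3 \<times> (0,T')\<close>.
\<close>

definition L2_H2_with_derivatives ::
    "(real^3 \<Rightarrow> real \<Rightarrow> real) \<Rightarrow> (3 \<Rightarrow> real^3 \<Rightarrow> real \<Rightarrow> real)
      \<Rightarrow> (3 \<Rightarrow> 3 \<Rightarrow> real^3 \<Rightarrow> real \<Rightarrow> real) \<Rightarrow> bool" where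
  "L2_H2_with_derivatives u p q \<longleftrightarrow>
     (AE t in lebesgue_on {0<..}.
        H2_with_derivatives (\<lambda>x. u x t) (\<lambda>i x. p i x t) (\<lambda>i j x. q i j x t)) \<and>
     (\<forall>T'>0.
        (\<lambda>(x, t). u x t) square_integrable_on (UNIV \<times> {0<..<T'}) \<and>
        (\<forall>i. (\<lambda>(x, t). p i x t) square_integrable_on (UNIV \<times> {0<..<T'})) \<and>
        (\<forall>i j. (\<lambda>(x, t). q i j x t) square_integrable_on (UNIV \<times> {0<..<T'})))"

text \<open>
  Strong solutions of \<open>\<partial>\<^sub>t u - \<Delta> u = F\<close> in \<open>\<real>\<^sup>3 \<times> (0,\<infinity>)\<close>, \<open>u(\<cdot>,0) = 0\<close>, in the class
  \<open>L\<^sup>2(0,T';H\<^sup>2(\<real>\<^sup>3))\<close> for every \<open>T' > 0\<close>. The last two conjuncts state the initial condition: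
  \<open>u(\<cdot>,t)\<close> tends to \<open>u(\<cdot>,0) = 0\<close> in \<open>L\<^sup>2(\<real>\<^sup>3)\<close>. Without them, the value at \<open>t = 0\<close> would
  not be tied to the values at positive times.
\<close>

definition heat_solution ::
    "(real^3 \<Rightarrow> real \<Rightarrow> real) \<Rightarrow> (real^3 \<Rightarrow> real \<Rightarrow> real) \<Rightarrow> bool" where
  "heat_solution F u \<longleftrightarrow>
     (\<exists>p q. L2_H2_with_derivatives u p q \<and>
        weak_derivative (UNIV \<times> {0<..}) (0, 1)
          (\<lambda>(x, t). u x t) (\<lambda>(x, t). (\<Sum>i\<in>UNIV. q i i x t) + F x t)) \<and>
     (\<forall>x. u x 0 = 0) \<and>
     (\<forall>\<^sub>F t in at_right 0. (\<lambda>x. u x t) square_integrable_on UNIV) \<and>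
     ((\<lambda>t. LINT x|lebesgue. (u x t)\<^sup>2) \<longlongrightarrow> 0) (at_right 0)"

definition heat_kernel :: "real^3 \<Rightarrow> real \<Rightarrow> real" where
  "heat_kernel x t = 1 / (4 * pi * t) powr (3/2) * exp (- (norm x)\<^sup>2 / (4 * t))"

definition duhamel :: "(real^3 \<Rightarrow> real \<Rightarrow> real) \<Rightarrow> real^3 \<Rightarrow> real \<Rightarrow> real" where
  "duhamel F x t =
     (LINT s|lebesgue_on {0..t}. LINT y|lebesgue. heat_kernel (x - y) (t - s) * F y s)"

definition moving_source ::
    "(real^3 \<Rightarrow> real) \<Rightarrow> (real \<Rightarrow> real) \<Rightarrow> (real \<Rightarrow> real^3) \<Rightarrow> real^3 \<Rightarrow> real \<Rightarrow> real" where
  "moving_source f g a x t = f (x - a t) * g t"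

end

theory Submission
  imports Defs "HOL-Complex_Analysis.Complex_Analysis" "HOL-Probability.Distributions"
    "HOL-Real_Asymp.Real_Asymp"
begin

text \<open>
  Outside the ball of radius \<open>R1 + R2\<close>, which contains all the sources, \<open>u(r \<omega>, T)\<close> is a real
  analytic function of \<open>r\<close>. So the data determine \<open>u(\<cdot>, T)\<close> on the whole space, and integrating
  it against \<open>exp (p \<bullet> x)\<close> gives \<open>F(p) exp (T |p|\<^sup>2) \<integral>\<^sub>0\<^sup>T exp (- |p|\<^sup>2 s + p \<bullet> a(s)) g(s) ds\<close>, where
  \<open>F(p) = \<integral> f(z) exp (p \<bullet> z) dz\<close> is analytic in \<open>p\<close> and does not vanish identically. Hence both orbits
  have the same exponential moments \<open>\<integral>\<^sub>0\<^sup>T exp (- |p|\<^sup>2 s + p \<bullet> a(s)) g(s) ds\<close>. With \<open>p = z e\<^sub>j\<close> the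
  problem becomes one-dimensional, for \<open>\<alpha> = a\<^sub>j\<close> and \<open>\<beta> = b\<^sub>j\<close>.

  If \<open>\<alpha>(t\<^sub>0) = \<beta>(t\<^sub>0) = x\<^sub>0\<close>, then
  \<open>A(z) = \<integral>\<^sub>0\<^bsup>t\<^sub>0\<^esup> exp (z\<^sup>2 (t\<^sub>0 - s)) (exp (z (\<alpha>(s) - x\<^sub>0)) - exp (z (\<beta>(s) - x\<^sub>0))) g(s) ds\<close> equals minus the
  same integral over \<open>[t\<^sub>0, T]\<close>. Using the first form where \<open>Re z\<^sup>2 \<le> 0\<close>, the second where
  \<open>Re z\<^sup>2 \<ge> 0\<close>, and \<open>|\<alpha>(s) - x\<^sub>0|, |\<beta>(s) - x\<^sub>0| \<le> L |s - t\<^sub>0|\<close>, the entire function \<open>A\<close> is of exponential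
  type and bounded where \<open>|Im z\<^sup>2| \<le> |Re z\<^sup>2|\<close>. By Phragmen-Lindelof it is bounded, hence constant, hence
  \<open>A = A(0) = 0\<close>. So the moments agree on every interval between two meeting times of \<open>\<alpha>\<close> and
  \<open>\<beta>\<close>; but if \<open>\<alpha> > \<beta>\<close> inside such an interval, the moments with \<open>z = 1\<close> differ.
\<close>

section \<open>Phragmen-Lindelof and entire integrals\<close>

text \<open>The part of the plane where \<open>bound\<close> is silent consists of four sectors of
  opening pi/4 around the diagonals, which are narrow enough for the maximum modulus principle to
  survive exponential growth. The sign \<open>\<sigma>\<close> picks one pair of opposite sectors,
  and damping by exp (i \<epsilon> \<sigma> z^2) makes the function small far out in them.\<close>

lemma phragmen_lindelof_quadrants:
  fixes f :: "complex \<Rightarrow> complex"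
  assumes hol: "f holomorphic_on UNIV" and M: "M > 0"
    and growth: "\<And>z. norm (f z) \<le> C * exp (X * norm z)"
    and bound: "\<And>z. \<bar>Im (z\<^sup>2)\<bar> \<le> \<bar>Re (z\<^sup>2)\<bar> \<Longrightarrow> norm (f z) \<le> M"
  shows "norm (f z) \<le> M"
proof -
  have C0: "C \<ge> 0" using order_trans[OF norm_ge_zero growth[of 0]] by simp
  have sector: "norm (f z) \<le> M"
    if z: "\<bar>Re (z\<^sup>2)\<bar> < \<sigma> * Im (z\<^sup>2)" and \<sigma>: "\<sigma> = 1 \<or> \<sigma> = -1" for z and \<sigma> :: real
  proof -
    have damped: "norm (f z) * exp (- \<epsilon> * (\<sigma> * Im (z\<^sup>2))) \<le> M" if \<epsilon>: "\<epsilon> > 0" for \<epsilon>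
    proof -
      (* On the sector \<sigma> Im w^2 >= |w|^2 / 2, so this factor beats any exponential growth. *)
      define h where "h w = f w * exp (\<i> * of_real (\<epsilon> * \<sigma>) * w\<^sup>2)" for w
      have norm_h: "norm (h w) = norm (f w) * exp (- \<epsilon> * (\<sigma> * Im (w\<^sup>2)))" for w
        by (simp add: h_def norm_mult)
      have "filterlim (\<lambda>r::real. r * (\<epsilon>/2 * r - X)) at_top at_top"
        using \<epsilon> by real_asymp
      then have "((\<lambda>r. exp (- (r * (\<epsilon>/2 * r - X)))) \<longlongrightarrow> 0) at_top"
        by (intro filterlim_compose[OF exp_at_bot]) (simp add: filterlim_uminus_at_top[symmetric])
      then have "((\<lambda>r::real. C * exp (X * r) * exp (- (\<epsilon>/2) * r\<^sup>2)) \<longlongrightarrow> 0) at_top"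
        using tendsto_mult_right_zero[of "\<lambda>r. exp (- (r * (\<epsilon>/2 * r - X)))" at_top C]
        by (simp add: mult.assoc exp_add[symmetric] power2_eq_square algebra_simps)
      with M have "\<forall>\<^sub>F r in at_top. C * exp (X * r) * exp (- (\<epsilon>/2) * r\<^sup>2) < M"
        by (simp add: order_tendstoD)
      then have "\<forall>\<^sub>F r in at_top. C * exp (X * r) * exp (- (\<epsilon>/2) * r\<^sup>2) < M \<and> norm z < r"
        using eventually_gt_at_top[of "norm z"] by (rule eventually_conj)
      \<comment> \<open>On the arc of radius \<open>\<rho>\<close> the Gaussian damping outweighs
        the exponential growth, and the arc lies beyond \<open>z\<close>.\<close>
      then obtain \<rho> where \<rho>: "C * exp (X * \<rho>) * exp (- (\<epsilon>/2) * \<rho>\<^sup>2) < M" "norm z < \<rho>"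
        using eventually_happens trivial_limit_at_top_linorder by blast
      define S where "S = {w. \<bar>Re (w\<^sup>2)\<bar> < \<sigma> * Im (w\<^sup>2) \<and> norm w < \<rho>}"
      define S' where "S' = {w. \<bar>Re (w\<^sup>2)\<bar> \<le> \<sigma> * Im (w\<^sup>2) \<and> norm w \<le> \<rho>}"
      have "open S"
        unfolding S_def by (intro open_Collect_conj open_Collect_less continuous_intros)
      have "closed S'"
        unfolding S'_def by (intro closed_Collect_conj closed_Collect_le continuous_intros)
      then have "closure S \<subseteq> S'"
        by (intro closure_minimal) (auto simp: S_def S'_def)
      have hol_h: "h holomorphic_on A" for A
        unfolding h_def by (intro holomorphic_intros holomorphic_on_subset[OF hol]) auto
      have "norm (h z) \<le> M"
      proof (rule maximum_modulus_frontier[where f=h and S=S])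
        show "h holomorphic_on interior S" by (rule hol_h)
        show "continuous_on (closure S) h" by (rule holomorphic_on_imp_continuous_on[OF hol_h])
        show "bounded S" unfolding S_def bounded_iff by (auto intro: less_imp_le)
        show "z \<in> S" using z \<rho> by (simp add: S_def)
        fix w assume "w \<in> frontier S"
        then have w: "w \<in> S'" "w \<notin> S"
          using \<open>closure S \<subseteq> S'\<close> \<open>open S\<close> by (auto simp: frontier_def interior_open)
        show "norm (h w) \<le> M"
        \<comment> \<open>The frontier consists of arcs, where the choice of \<open>\<rho>\<close>
          decides, and of pieces of the rays with |Re w^2| = \<sigma> Im w^2, where
          \<open>bound\<close> applies and the damping factor is at most 1.\<close>
        proof (cases "norm w = \<rho>")
          case True
          have "(norm w)\<^sup>2 = norm (w\<^sup>2)" by (simp add: norm_power)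
          also have "\<dots> \<le> \<bar>Re (w\<^sup>2)\<bar> + \<bar>Im (w\<^sup>2)\<bar>" by (rule cmod_le)
          also have "\<dots> \<le> 2 * (\<sigma> * Im (w\<^sup>2))" using w(1) \<sigma> by (auto simp: S'_def)
          finally have "\<rho>\<^sup>2 / 2 \<le> \<sigma> * Im (w\<^sup>2)" using True by simp
          then have "exp (- \<epsilon> * (\<sigma> * Im (w\<^sup>2))) \<le> exp (- \<epsilon> * (\<rho>\<^sup>2 / 2))"
            using \<epsilon> by simp
          then have "norm (h w) \<le> (C * exp (X * \<rho>)) * exp (- \<epsilon> * (\<rho>\<^sup>2 / 2))"
            unfolding norm_h using growth[of w] True C0 by (intro mult_mono) auto
          then show ?thesis using \<rho> by (simp add: field_simps)
        next
          case False
          then have eq: "\<bar>Re (w\<^sup>2)\<bar> = \<sigma> * Im (w\<^sup>2)"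
            using w by (auto simp: S_def S'_def)
          then have "norm (f w) \<le> M" using bound[of w] \<sigma> by auto
          moreover have "exp (- \<epsilon> * (\<sigma> * Im (w\<^sup>2))) \<le> 1"
            using \<epsilon> eq[symmetric] by (simp del: Re_power2 Im_power2 add: mult_nonneg_nonneg)
          ultimately show ?thesis
            unfolding norm_h using mult_mono[of "norm (f w)" M _ 1] M by simp
        qed
      qed
      then show ?thesis by (simp only: norm_h)
    qed
    \<comment> \<open>With \<open>z\<close> fixed, the damping disappears as
      \<open>\<epsilon>\<close> tends to 0.\<close>
    have lim: "((\<lambda>\<epsilon>. norm (f z) * exp (- \<epsilon> * (\<sigma> * Im (z\<^sup>2)))) \<longlongrightarrow> norm (f z) * exp (- 0 * (\<sigma> * Im (z\<^sup>2)))) (at_right 0)"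
      by (intro tendsto_intros)
    have "\<forall>\<^sub>F \<epsilon> in at_right (0::real). norm (f z) * exp (- \<epsilon> * (\<sigma> * Im (z\<^sup>2))) \<le> M"
      using damped by (auto simp: eventually_at_filter)
    then show ?thesis
      using tendsto_upperbound[OF lim] by simp
  qed
  show ?thesis
    using bound[of z] sector[of z 1] sector[of z "-1"] by linarith
qed

text \<open>Differentiation under the integral over a compact interval. The general coefficients
  serve both the moments of an orbit on the line and the moments along a line of frequencies in
  space.\<close>

lemma exp_quadratic_integral_holomorphic:
  fixes u v w :: "real \<Rightarrow> complex"
  assumes "continuous_on {c..d} u" "continuous_on {c..d} v" "continuous_on {c..d} w"
  shows "(\<lambda>z. integral {c..d} (\<lambda>s. exp (z\<^sup>2 * u s + z * v s) * w s)) holomorphic_on UNIV"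
proof -
  have "((\<lambda>z. exp (z\<^sup>2 * u s + z * v s) * w s) has_field_derivative
          (2 * z * u s + v s) * exp (z\<^sup>2 * u s + z * v s) * w s) (at z within UNIV)" for z s
    by (auto intro!: derivative_eq_intros simp: algebra_simps)
  moreover have "continuous_on (UNIV \<times> cbox c d)
      (\<lambda>(z, s). (2 * z * u s + v s) * exp (z\<^sup>2 * u s + z * v s) * w s)"
    unfolding case_prod_beta
    by (intro continuous_intros continuous_on_compose2[OF assms(1)]
        continuous_on_compose2[OF assms(2)] continuous_on_compose2[OF assms(3)]) auto
  moreover have "(\<lambda>s. exp (z\<^sup>2 * u s + z * v s) * w s) integrable_on cbox c d" for z
    using assms by (intro integrable_continuous continuous_intros) auto
  ultimately show ?thesis
    using leibniz_rule_holomorphic[of UNIV c d "\<lambda>z s. exp (z\<^sup>2 * u s + z * v s) * w s"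
        "\<lambda>z s. (2 * z * u s + v s) * exp (z\<^sup>2 * u s + z * v s) * w s"] by simp
qed

text \<open>The identity theorem, as 0 is an accumulation point of the real interval. The local form
  with \<open>\<delta>\<close> is for frequencies on a line, where agreement is first known only
  near one point.\<close>

lemma entire_eq_on_reals:
  assumes "f holomorphic_on UNIV" "g holomorphic_on UNIV" "\<delta> > 0"
    and eq: "\<And>r::real. \<bar>r\<bar> < \<delta> \<Longrightarrow> f (of_real r) = g (of_real r)"
  shows "f z = g z"
proof -
  have "(0::complex) islimpt of_real ` {-\<delta><..<\<delta>}"
    unfolding islimpt_approachable
  proof (intro allI impI)
    fix e :: real assume "e > 0"
    then show "\<exists>x'\<in>of_real ` {-\<delta><..<\<delta>}. x' \<noteq> (0::complex) \<and> dist x' 0 < e"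
      using \<open>\<delta> > 0\<close> by (intro bexI[of _ "of_real (min \<delta> e / 2)"]) (auto simp del: of_real_divide)
  qed
  moreover have "(\<lambda>z. f z - g z) holomorphic_on UNIV"
    using assms by (intro holomorphic_intros)
  ultimately have "f z - g z = 0"
    using analytic_continuation[of "\<lambda>z. f z - g z" UNIV "of_real ` {-\<delta><..<\<delta>}" 0 z] eq
    by (fastforce simp: abs_less_iff)
  then show ?thesis by simp
qed

section \<open>Orbits on the line\<close>

text \<open>The prefactor recentres the exponent at (\<open>t0\<close>, \<open>x0\<close>): its real
  part becomes Re (z^2) (t0 - s) + Re z (v s - x0), and \<open>lip\<close> controls the second
  summand.\<close>

lemma exp_quadratic_integral_bound:
  fixes v g :: "real \<Rightarrow> real" and z :: complex
  assumes "c \<le> d" and v: "continuous_on {c..d} v" and g: "continuous_on {c..d} g"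
    and gB: "\<And>s. s \<in> {c..d} \<Longrightarrow> \<bar>g s\<bar> \<le> B"
    and lip: "\<And>s. s \<in> {c..d} \<Longrightarrow> \<bar>v s - x0\<bar> \<le> L * \<bar>t0 - s\<bar>"
    and E: "\<And>s. s \<in> {c..d} \<Longrightarrow> Re (z\<^sup>2) * (t0 - s) + norm z * L * \<bar>t0 - s\<bar> \<le> E"
  shows "norm (exp (z\<^sup>2 * of_real t0 - z * of_real x0) *
      integral {c..d} (\<lambda>s. exp (z\<^sup>2 * - of_real s + z * of_real (v s)) * of_real (g s)))
    \<le> B * exp E * (d - c)"
proof -
  have "norm (integral {c..d} (\<lambda>s. exp (z\<^sup>2 * of_real t0 - z * of_real x0) *
      (exp (z\<^sup>2 * - of_real s + z * of_real (v s)) * of_real (g s)))) \<le> B * exp E * (d - c)"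
  proof (rule integral_bound)
    show "continuous_on {c..d} (\<lambda>s. exp (z\<^sup>2 * of_real t0 - z * of_real x0) *
      (exp (z\<^sup>2 * - of_real s + z * of_real (v s)) * of_real (g s)))"
      by (intro continuous_intros v g)
    fix s assume s: "s \<in> {c..d}"
    have "Re z * (v s - x0) \<le> norm z * \<bar>v s - x0\<bar>"
      by (rule order_trans[OF abs_ge_self]) (simp add: abs_mult abs_Re_le_cmod mult_right_mono)
    also have "\<dots> \<le> norm z * (L * \<bar>t0 - s\<bar>)"
      using lip[OF s] by (intro mult_left_mono) auto
    finally have *: "Re (z\<^sup>2) * (t0 - s) + Re z * (v s - x0) \<le> E"
      using E[OF s] by simp
    have "norm (exp (z\<^sup>2 * of_real t0 - z * of_real x0) *
      (exp (z\<^sup>2 * - of_real s + z * of_real (v s)) * of_real (g s)))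
      = exp (Re (z\<^sup>2) * (t0 - s) + Re z * (v s - x0)) * \<bar>g s\<bar>"
      by (simp add: norm_mult exp_add[symmetric] algebra_simps mult_exp_exp del: Re_power2)
    also have "\<dots> \<le> exp E * B"
      using * gB[OF s] by (intro mult_mono) auto
    finally show "norm (exp (z\<^sup>2 * of_real t0 - z * of_real x0) *
      (exp (z\<^sup>2 * - of_real s + z * of_real (v s)) * of_real (g s))) \<le> B * exp E"
      by (simp add: mult.commute)
  qed (use assms in auto)
  then show ?thesis by simp
qed

text \<open>Since the curves meet at \<open>t0\<close>, a single factor recentres both of them. The
  difference of the recentred moments over [0, t0] is then minus that over [t0, T], and for every z
  one of these two forms has a decaying quadratic exponential.\<close>

lemma exp_moments_split_at_meeting_time:
  fixes \<alpha> \<beta> g :: "real \<Rightarrow> real"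
  defines "\<Phi> \<equiv> \<lambda>c d v z. integral {c..d}
     (\<lambda>s. exp (z\<^sup>2 * - of_real s + z * of_real (v s)) * of_real (g s) :: complex)"
  assumes g: "continuous_on {0..T} g"
    and \<alpha>: "\<And>s t. s \<in> {0..T} \<Longrightarrow> t \<in> {0..T} \<Longrightarrow> \<bar>\<alpha> s - \<alpha> t\<bar> \<le> L * \<bar>s - t\<bar>"
    and \<beta>: "\<And>s t. s \<in> {0..T} \<Longrightarrow> t \<in> {0..T} \<Longrightarrow> \<bar>\<beta> s - \<beta> t\<bar> \<le> L * \<bar>s - t\<bar>"
    and L: "L > 0"
    and eq: "\<And>z. \<Phi> 0 T \<alpha> z = \<Phi> 0 T \<beta> z"
    and t0: "t0 \<in> {0..T}" "\<alpha> t0 = \<beta> t0"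
  shows "\<Phi> 0 t0 \<alpha> z = \<Phi> 0 t0 \<beta> z"
proof -
  have cont: "continuous_on {0..T} v"
    if "\<And>s t. s \<in> {0..T} \<Longrightarrow> t \<in> {0..T} \<Longrightarrow> \<bar>v s - v t\<bar> \<le> L * \<bar>s - t\<bar>" for v :: "real \<Rightarrow> real"
    by (rule lipschitz_on_continuous_on[of L]) (use that L in \<open>auto simp: lipschitz_on_def dist_real_def\<close>)
  note cont_\<alpha> = cont[OF \<alpha>] and cont_\<beta> = cont[OF \<beta>]
  have "compact (g ` {0..T})" using g by (intro compact_continuous_image) auto
  then obtain B where B: "B > 0" "\<And>s. s \<in> {0..T} \<Longrightarrow> \<bar>g s\<bar> \<le> B"
    using compact_imp_bounded bounded_pos[of "g ` {0..T}"] by auto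
  define x0 where "x0 = \<alpha> t0"
  define e where "e z = exp (z\<^sup>2 * of_real t0 - z * of_real x0)" for z :: complex
  define A where "A z = e z * \<Phi> 0 t0 \<alpha> z - e z * \<Phi> 0 t0 \<beta> z" for z
  have hol: "\<Phi> 0 t0 v holomorphic_on UNIV" if "continuous_on {0..T} v" for v
    unfolding \<Phi>_def using t0
    by (intro exp_quadratic_integral_holomorphic continuous_intros
        continuous_on_subset[OF that] continuous_on_subset[OF g]) auto
  have hol_A: "A holomorphic_on UNIV"
    unfolding A_def e_def by (intro holomorphic_intros hol cont_\<alpha> cont_\<beta>)
  have split: "\<Phi> 0 t0 v z + \<Phi> t0 T v z = \<Phi> 0 T v z" if "continuous_on {0..T} v" for v z
    unfolding \<Phi>_def using t0 that g
    by (intro Henstock_Kurzweil_Integration.integral_combine integrable_continuous_interval continuous_intros) auto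
  have A': "A z = e z * \<Phi> t0 T \<beta> z - e z * \<Phi> t0 T \<alpha> z" for z
  proof -
    have "\<Phi> 0 t0 \<alpha> z - \<Phi> 0 t0 \<beta> z = \<Phi> t0 T \<beta> z - \<Phi> t0 T \<alpha> z"
      using split[OF cont_\<alpha>, of z] split[OF cont_\<beta>, of z] eq[of z] by (simp add: algebra_simps)
    then show ?thesis
      unfolding A_def right_diff_distrib[symmetric] by simp
  qed
  have piece: "norm (e z * \<Phi> c d v z) \<le> B * exp E * T"
    if cd: "0 \<le> c" "c \<le> d" "d \<le> T" and v: "continuous_on {0..T} v"
      and lip: "\<And>s. s \<in> {0..T} \<Longrightarrow> \<bar>v s - x0\<bar> \<le> L * \<bar>t0 - s\<bar>"
      and E: "\<And>s. s \<in> {c..d} \<Longrightarrow> Re (z\<^sup>2) * (t0 - s) + norm z * L * \<bar>t0 - s\<bar> \<le> E"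
    for c d v z E
  proof -
    have "norm (e z * \<Phi> c d v z) \<le> B * exp E * (d - c)"
      unfolding e_def \<Phi>_def using cd
      by (intro exp_quadratic_integral_bound[where L=L] E continuous_on_subset[OF v]
          continuous_on_subset[OF g] B lip) auto
    also have "\<dots> \<le> B * exp E * T" using cd B by (intro mult_left_mono) auto
    finally show ?thesis .
  qed
  have lips: "\<bar>\<alpha> s - x0\<bar> \<le> L * \<bar>t0 - s\<bar>" "\<bar>\<beta> s - x0\<bar> \<le> L * \<bar>t0 - s\<bar>" if "s \<in> {0..T}" for s
    using \<alpha>[OF that t0(1)] \<beta>[OF that t0(1)] t0(2) by (auto simp: x0_def abs_minus_commute)
  \<comment> \<open>Here \<open>\<tau>\<close> stands for |s - t0|. The sign of Re (z^2) selects the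
    form of \<open>A\<close> in which Re (z^2) (t0 - s) equals - |Re (z^2)| \<tau>.\<close>
  have A_le: "norm (A z) \<le> 2 * B * T * exp E"
    if E: "\<And>\<tau>. \<tau> \<in> {0..T} \<Longrightarrow> (norm z * L - \<bar>Re (z\<^sup>2)\<bar>) * \<tau> \<le> E" for z E
  proof (cases "Re (z\<^sup>2) \<le> 0")
    case True
    have E': "Re (z\<^sup>2) * (t0 - s) + norm z * L * \<bar>t0 - s\<bar> \<le> E" if "s \<in> {0..t0}" for s
      using E[of "t0 - s"] True t0 that by (simp add: algebra_simps)
    have "norm (e z * \<Phi> 0 t0 \<alpha> z) \<le> B * exp E * T"
      using t0 by (intro piece[OF _ _ _ cont_\<alpha> lips(1) E']) auto
    moreover have "norm (e z * \<Phi> 0 t0 \<beta> z) \<le> B * exp E * T"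
      using t0 by (intro piece[OF _ _ _ cont_\<beta> lips(2) E']) auto
    ultimately show ?thesis
      using norm_triangle_ineq4[of "e z * \<Phi> 0 t0 \<alpha> z" "e z * \<Phi> 0 t0 \<beta> z"]
      unfolding A_def by (simp add: mult.commute mult.left_commute)
  next
    case False
    have E': "Re (z\<^sup>2) * (t0 - s) + norm z * L * \<bar>t0 - s\<bar> \<le> E" if "s \<in> {t0..T}" for s
      using E[of "s - t0"] False t0 that by (simp add: algebra_simps)
    have "norm (e z * \<Phi> t0 T \<alpha> z) \<le> B * exp E * T"
      using t0 by (intro piece[OF _ _ _ cont_\<alpha> lips(1) E']) auto
    moreover have "norm (e z * \<Phi> t0 T \<beta> z) \<le> B * exp E * T"
      using t0 by (intro piece[OF _ _ _ cont_\<beta> lips(2) E']) auto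
    ultimately show ?thesis
      using norm_triangle_ineq4[of "e z * \<Phi> t0 T \<beta> z" "e z * \<Phi> t0 T \<alpha> z"]
      unfolding A' by (simp add: mult.commute mult.left_commute)
  qed
  have T0: "T \<ge> 0" using t0 by auto
  \<comment> \<open>The summand 1 keeps \<open>M\<close> positive even when \<open>T\<close> is
    0.\<close>
  define M where "M = 2 * B * (T + 1) * exp (2 * L\<^sup>2 * T)"
  have "M > 0" using B T0 by (simp add: M_def)
  have "norm (A z) \<le> M" for z
  proof (rule phragmen_lindelof_quadrants[OF hol_A \<open>M > 0\<close>])
    fix z :: complex
    show "norm (A z) \<le> (2 * B * T) * exp ((L * T) * norm z)"
    proof (rule A_le)
      fix \<tau> assume \<tau>: "\<tau> \<in> {0..T}"
      have "(norm z * L - \<bar>Re (z\<^sup>2)\<bar>) * \<tau> \<le> norm z * L * \<tau>"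
        using \<tau> by (intro mult_right_mono) auto
      also have "\<dots> \<le> norm z * L * T" using \<tau> L by (intro mult_left_mono) auto
      finally show "(norm z * L - \<bar>Re (z\<^sup>2)\<bar>) * \<tau> \<le> L * T * norm z" by (simp add: ac_simps)
    qed
  next
    fix z :: complex assume "\<bar>Im (z\<^sup>2)\<bar> \<le> \<bar>Re (z\<^sup>2)\<bar>"
    then have "(norm z)\<^sup>2 \<le> 2 * \<bar>Re (z\<^sup>2)\<bar>"
      using cmod_le[of "z\<^sup>2"] by (simp add: norm_power)
    then have "norm z * L - \<bar>Re (z\<^sup>2)\<bar> \<le> norm z * (L - norm z / 2)"
      by (simp add: power2_eq_square algebra_simps)
    \<comment> \<open>With n = |z|, the sum of squares (L - n/2)^2 + (n/2)^2 equals L^2 - (n L -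
      n^2/2).\<close>
    also have "\<dots> \<le> L\<^sup>2"
      using add_nonneg_nonneg[OF zero_le_power2[of "L - norm z / 2"] zero_le_power2[of "norm z / 2"]]
      by (simp add: power2_eq_square field_simps)
    finally have le: "norm z * L - \<bar>Re (z\<^sup>2)\<bar> \<le> L\<^sup>2" .
    have "norm (A z) \<le> 2 * B * T * exp (2 * L\<^sup>2 * T)"
    proof (rule A_le)
      fix \<tau> assume \<tau>: "\<tau> \<in> {0..T}"
      have "(norm z * L - \<bar>Re (z\<^sup>2)\<bar>) * \<tau> \<le> L\<^sup>2 * \<tau>"
        using \<tau> le by (intro mult_right_mono) auto
      also have "\<dots> \<le> (2 * L\<^sup>2) * T" using \<tau> by (intro mult_mono) auto
      finally show "(norm z * L - \<bar>Re (z\<^sup>2)\<bar>) * \<tau> \<le> 2 * L\<^sup>2 * T" .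
    qed
    also have "\<dots> \<le> M" unfolding M_def using B by (intro mult_right_mono mult_left_mono) auto
    finally show "norm (A z) \<le> M" .
  qed
  then have "A constant_on UNIV"
    using hol_A by (intro Liouville_theorem) (auto simp: bounded_iff)
  then have "A z = A 0" by (auto simp: constant_on_def)
  \<comment> \<open>At z = 0 all exponentials are 1, so both moments are the same integral of
    \<open>g\<close>.\<close>
  also have "A 0 = 0" by (simp add: A_def \<Phi>_def)
  finally show ?thesis by (simp add: A_def e_def)
qed

lemma integral_exp_moment_of_real:
  fixes v g :: "real \<Rightarrow> real"
  assumes "continuous_on {c..d} v" "continuous_on {c..d} g"
  shows "integral {c..d} (\<lambda>s. exp ((of_real r)\<^sup>2 * - of_real s + of_real r * of_real (v s)) * of_real (g s) :: complex)
     = of_real (integral {c..d} (\<lambda>s. exp (- r\<^sup>2 * s + r * v s) * g s))"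
proof -
  have "(\<lambda>s. exp (- r\<^sup>2 * s + r * v s) * g s) integrable_on {c..d}"
    using assms by (intro integrable_continuous_interval continuous_intros)
  then have "((\<lambda>s. complex_of_real (exp (- r\<^sup>2 * s + r * v s) * g s)) has_integral
      of_real (integral {c..d} (\<lambda>s. exp (- r\<^sup>2 * s + r * v s) * g s))) {c..d}"
    by (intro has_integral_of_real integrable_integral)
  then show ?thesis
    by (intro integral_unique) (simp add: exp_of_real[symmetric])
qed

text \<open>If \<open>\<alpha>\<close> exceeded \<open>\<beta>\<close> at \<open>t\<close>, it would
  do so on a whole interval around \<open>t\<close> bounded by meeting times, or by \<open>T\<close>
  on the right. Splitting at its ends shows that the moments agree over this interval alone,
  contradicting monotonicity of the exponential. The inequality is one-sided because exchanging the
  orbits gives the other half.\<close>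

lemma orbit_unique_of_exp_moments:
  fixes \<alpha> \<beta> g :: "real \<Rightarrow> real"
  assumes T: "T > 0"
    and g: "continuous_on {0..T} g"
    and g_pos: "\<And>t. t \<in> {0<..<T} \<Longrightarrow> g t > 0"
    and \<alpha>: "\<And>s t. s \<in> {0..T} \<Longrightarrow> t \<in> {0..T} \<Longrightarrow> \<bar>\<alpha> s - \<alpha> t\<bar> \<le> L * \<bar>s - t\<bar>"
    and \<beta>: "\<And>s t. s \<in> {0..T} \<Longrightarrow> t \<in> {0..T} \<Longrightarrow> \<bar>\<beta> s - \<beta> t\<bar> \<le> L * \<bar>s - t\<bar>"
    and L: "L > 0"
    and start: "\<alpha> 0 = \<beta> 0"
    and eq: "\<And>r. integral {0..T} (\<lambda>s. exp (- r\<^sup>2 * s + r * \<alpha> s) * g s)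
                = integral {0..T} (\<lambda>s. exp (- r\<^sup>2 * s + r * \<beta> s) * g s)"
    and t: "t \<in> {0..T}"
  shows "\<alpha> t \<le> \<beta> t"
proof (rule ccontr)
  assume "\<not> \<alpha> t \<le> \<beta> t"
  then have gt: "\<beta> t < \<alpha> t" by simp
  have cont: "continuous_on {0..T} v"
    if "\<And>s t. s \<in> {0..T} \<Longrightarrow> t \<in> {0..T} \<Longrightarrow> \<bar>v s - v t\<bar> \<le> L * \<bar>s - t\<bar>" for v :: "real \<Rightarrow> real"
    by (rule lipschitz_on_continuous_on[of L]) (use that L in \<open>auto simp: lipschitz_on_def dist_real_def\<close>)
  have cont_\<alpha>: "continuous_on {0..T} \<alpha>" and cont_\<beta>: "continuous_on {0..T} \<beta>"
    using cont \<alpha> \<beta> by blast+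
  define \<delta> where "\<delta> s = \<alpha> s - \<beta> s" for s
  have cont_\<delta>: "continuous_on {0..T} \<delta>"
    unfolding \<delta>_def by (intro continuous_intros cont_\<alpha> cont_\<beta>)
  define \<Phi> where "\<Phi> c d v z = integral {c..d}
     (\<lambda>s. exp (z\<^sup>2 * - of_real s + z * of_real (v s)) * of_real (g s) :: complex)" for c d v z
  have hol: "\<Phi> 0 T v holomorphic_on UNIV" if "continuous_on {0..T} v" for v
    unfolding \<Phi>_def
    by (intro exp_quadratic_integral_holomorphic continuous_intros that g)
  have eq_real: "\<Phi> 0 T \<alpha> (of_real r) = \<Phi> 0 T \<beta> (of_real r)" for r
    unfolding \<Phi>_def integral_exp_moment_of_real[OF cont_\<alpha> g]
      integral_exp_moment_of_real[OF cont_\<beta> g] eq ..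
  have eq_\<Phi>: "\<Phi> 0 T \<alpha> z = \<Phi> 0 T \<beta> z" for z
    by (rule entire_eq_on_reals[OF hol[OF cont_\<alpha>] hol[OF cont_\<beta>] zero_less_one]) (rule eq_real)
  have split: "\<Phi> 0 t0 \<alpha> z = \<Phi> 0 t0 \<beta> z" if "t0 \<in> {0..T}" "\<alpha> t0 = \<beta> t0" for t0 z
    using exp_moments_split_at_meeting_time[OF g \<alpha> \<beta> L _ that, of z] eq_\<Phi>
    unfolding \<Phi>_def by blast

  define K1 where "K1 = {s \<in> {0..t}. \<delta> s = 0}"
  \<comment> \<open>The orbits may fail to meet again after \<open>t\<close>. Inserting
    \<open>T\<close> is legitimate because the moments over all of [0, T] agree by
    \<open>eq\<close>.\<close>
  define K2 where "K2 = insert T {s \<in> {t..T}. \<delta> s = 0}"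
  have cpt: "compact {s \<in> {c..d}. \<delta> s = 0}" if "{c..d} \<subseteq> {0..T}" for c d
  proof -
    have "closed ({c..d} \<inter> \<delta> -` {0})"
      using that by (intro continuous_closed_preimage continuous_on_subset[OF cont_\<delta>]) auto
    then have "compact ({c..d} \<inter> ({c..d} \<inter> \<delta> -` {0}))"
      by (intro compact_Int_closed) auto
    also have "{c..d} \<inter> ({c..d} \<inter> \<delta> -` {0}) = {s \<in> {c..d}. \<delta> s = 0}" by auto
    finally show ?thesis .
  qed
  have "compact K1" "K1 \<noteq> {}" "compact K2" "K2 \<noteq> {}"
    using t start cpt[of 0 t] cpt[of t T] by (auto simp: K1_def K2_def \<delta>_def)
  obtain t1 where t1: "t1 \<in> K1" "\<And>s. s \<in> K1 \<Longrightarrow> s \<le> t1"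
    using compact_attains_sup[OF \<open>compact K1\<close> \<open>K1 \<noteq> {}\<close>] by blast
  obtain t2 where t2: "t2 \<in> K2" "\<And>s. s \<in> K2 \<Longrightarrow> t2 \<le> s"
    using compact_attains_inf[OF \<open>compact K2\<close> \<open>K2 \<noteq> {}\<close>] by blast
  have \<delta>t: "\<delta> t > 0" using gt by (simp add: \<delta>_def)
  have t12: "0 \<le> t1" "t1 < t" "t \<le> t2" "t2 \<le> T" "\<delta> t1 = 0" "\<delta> t2 = 0 \<or> t2 = T"
    using t1(1) t2(1) \<delta>t t by (auto simp: K1_def K2_def less_le)
  have pos: "\<delta> s > 0" if s: "t1 < s" "s < t2" for s
  proof (rule ccontr)
    assume "\<not> \<delta> s > 0"
    show False
    proof (cases "s \<le> t")
      case True
      then obtain x where "s \<le> x" "x \<le> t" "\<delta> x = 0"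
        using IVT'[of \<delta> s 0 t] \<open>\<not> \<delta> s > 0\<close> \<delta>t continuous_on_subset[OF cont_\<delta>, of "{s..t}"] s t12 by auto
      then show False using t1(2)[of x] s t12 by (auto simp: K1_def)
    next
      case False
      then obtain x where "t \<le> x" "x \<le> s" "\<delta> x = 0"
        using IVT2'[of \<delta> s 0 t] \<open>\<not> \<delta> s > 0\<close> \<delta>t continuous_on_subset[OF cont_\<delta>, of "{t..s}"] s t12 by auto
      then show False using t2(2)[of x] s t12 by (auto simp: K2_def)
    qed
  qed
  have "t1 < t2" using t12 by simp
  \<comment> \<open>At frequency 1 the integrand increases with the orbit value wherever
    \<open>g\<close> is positive. The spelled-out factors 1 match the general form with
    \<open>r\<close>.\<close>
  define I where "I v = integral {t1..t2} (\<lambda>s. exp (- 1\<^sup>2 * s + 1 * v s) * g s)" for v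
  have I: "of_real (I v) = \<Phi> 0 t2 v 1 - \<Phi> 0 t1 v 1" if "continuous_on {0..T} v" for v
  proof -
    have sub: "continuous_on {t1..t2} v" "continuous_on {t1..t2} g"
      using t12 by (auto intro: continuous_on_subset[OF that] continuous_on_subset[OF g])
    have "\<Phi> 0 t1 v 1 + \<Phi> t1 t2 v 1 = \<Phi> 0 t2 v 1"
      unfolding \<Phi>_def using t12 that g
      by (intro Henstock_Kurzweil_Integration.integral_combine integrable_continuous_interval continuous_intros)
        (auto intro: continuous_on_subset)
    moreover have "of_real (I v) = \<Phi> t1 t2 v 1"
      using integral_exp_moment_of_real[OF sub, of 1] by (simp add: I_def \<Phi>_def)
    ultimately show ?thesis by (simp add: algebra_simps)
  qed
  have "\<Phi> 0 t1 \<alpha> 1 = \<Phi> 0 t1 \<beta> 1"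
    using t12 by (intro split) (auto simp: \<delta>_def)
  moreover have "\<Phi> 0 t2 \<alpha> 1 = \<Phi> 0 t2 \<beta> 1"
    using t12 eq_\<Phi> by (cases "t2 = T") (auto intro!: split simp: \<delta>_def)
  ultimately have "complex_of_real (I \<alpha>) = of_real (I \<beta>)"
    by (simp add: I cont_\<alpha> cont_\<beta>)
  then have "I \<alpha> = I \<beta>" by simp
  have contI: "continuous_on {t1..t2} (\<lambda>s. exp (- 1\<^sup>2 * s + 1 * v s) * g s)"
    if "continuous_on {0..T} v" for v
    using t12 by (intro continuous_intros continuous_on_subset[OF that] continuous_on_subset[OF g]) auto
  define k where "k s = exp (- 1\<^sup>2 * s + 1 * \<alpha> s) * g s - exp (- 1\<^sup>2 * s + 1 * \<beta> s) * g s" for s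
  have "integral {t1..t2} k = I \<alpha> - I \<beta>"
    unfolding k_def I_def
    by (intro Henstock_Kurzweil_Integration.integral_diff integrable_continuous_interval contI cont_\<alpha> cont_\<beta>)
  with \<open>I \<alpha> = I \<beta>\<close> have "integral {t1..t2} k = 0" by simp
  moreover have contk: "continuous_on {t1..t2} k"
    unfolding k_def by (intro continuous_on_diff contI cont_\<alpha> cont_\<beta>)
  moreover have k_pos: "k s > 0" if "s \<in> {t1<..<t2}" for s
    using pos[of s] g_pos[of s] that t12
    by (simp add: k_def left_diff_distrib[symmetric] \<delta>_def)
  \<comment> \<open>At the endpoints the sign comes from continuity, as \<open>g\<close> is known to
    be positive only inside (0, T).\<close>
  moreover have "k s \<ge> 0" if "s \<in> {t1..t2}" for s
  proof (rule continuous_ge_on_closure[of "{t1<..<t2}" k])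
    show "continuous_on (closure {t1<..<t2}) k" "s \<in> closure {t1<..<t2}"
      using contk that \<open>t1 < t2\<close> by auto
  qed (use k_pos in \<open>auto intro: less_imp_le\<close>)
  ultimately have "\<forall>s\<in>{t1..t2}. k s = 0"
    using integral_eq_0_iff[OF contk \<open>t1 < t2\<close>] by simp
  then have "k ((t1 + t2) / 2) = 0" using \<open>t1 < t2\<close> by auto
  with k_pos[of "(t1 + t2) / 2"] \<open>t1 < t2\<close> show False by auto
qed

section \<open>Integrals depending holomorphically on a parameter, and exponential moments\<close>

text \<open>Local domination of \<open>F\<close> itself suffices: Cauchy's estimate turns it into a
  bound for the derivative in z, hence for the difference quotients, and dominated convergence gives
  the complex derivative of the integral.\<close>

lemma integral_holomorphic_dominated:
  fixes F :: "complex \<Rightarrow> 'a \<Rightarrow> complex"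
  assumes meas: "\<And>z. z \<in> S \<Longrightarrow> F z \<in> borel_measurable M"
    and hol: "\<And>\<omega>. \<omega> \<in> space M \<Longrightarrow> (\<lambda>z. F z \<omega>) holomorphic_on S"
    and dom: "\<And>z. z \<in> S \<Longrightarrow> \<exists>r>0. \<exists>B. integrable M B \<and> cball z r \<subseteq> S \<and>
                (\<forall>w\<in>cball z r. \<forall>\<omega>\<in>space M. norm (F w \<omega>) \<le> B \<omega>)"
  shows "(\<lambda>z. LINT \<omega>|M. F z \<omega>) holomorphic_on S"
proof -
  have "(\<lambda>z. LINT \<omega>|M. F z \<omega>) field_differentiable (at z)" if z: "z \<in> S" for z
  proof -
    obtain r B where r: "r > 0" and B: "integrable M B" and sub: "cball z r \<subseteq> S"
      and FB: "\<And>w \<omega>. w \<in> cball z r \<Longrightarrow> \<omega> \<in> space M \<Longrightarrow> norm (F w \<omega>) \<le> B \<omega>"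
      using dom[OF z] by blast
    have int: "integrable M (F w)" if "w \<in> cball z r" for w
      using that sub meas FB by (intro Bochner_Integration.integrable_bound[OF B] AE_I2) fastforce+
    define D where "D \<omega> = deriv (\<lambda>w. F w \<omega>) z" for \<omega>
    define q where "q w \<omega> = (F w \<omega> - F z \<omega>) / (w - z)" for w \<omega>
    have holr: "(\<lambda>w. F w \<omega>) holomorphic_on ball z r" "continuous_on (cball z r) (\<lambda>w. F w \<omega>)"
      if "\<omega> \<in> space M" for \<omega>
      using holomorphic_on_subset[OF hol[OF that] sub]
      by (auto intro: holomorphic_on_subset holomorphic_on_imp_continuous_on)
    have q_bound: "norm (q w \<omega>) \<le> 2 * B \<omega> / r" if w: "w \<in> ball z (r/2)" "w \<noteq> z" and \<omega>: "\<omega> \<in> space M" for w \<omega>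
    proof -
      \<comment> \<open>A disc of radius r/2 about a point of the half-radius ball stays within
        \<open>cball z r\<close>, which yields the constant 2/r.\<close>
      have deriv_bound: "norm (deriv (\<lambda>w. F w \<omega>) v) \<le> 2 * B \<omega> / r" if v: "v \<in> ball z (r/2)" for v
      proof -
        have sub_v: "cball v (r/2) \<subseteq> cball z r" "ball v (r/2) \<subseteq> ball z r"
          using v unfolding cball_subset_cball_iff ball_subset_ball_iff
          by (auto simp: dist_commute)
        have "norm ((deriv ^^ 1) (\<lambda>w. F w \<omega>) v) \<le> fact 1 * B \<omega> / (r/2) ^ 1"
        proof (rule Cauchy_inequality)
          show "(\<lambda>w. F w \<omega>) holomorphic_on ball v (r/2)" "continuous_on (cball v (r/2)) (\<lambda>w. F w \<omega>)"
            using holr[OF \<omega>] sub_v by (auto intro: holomorphic_on_subset continuous_on_subset)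
          fix x assume "norm (v - x) = r/2"
          then have "x \<in> cball z r" using sub_v(1) by (auto simp: dist_norm)
          then show "norm (F x \<omega>) \<le> B \<omega>" using FB \<omega> by blast
        qed (use r in auto)
        then show ?thesis by (simp add: field_simps)
      qed
      have "norm (F w \<omega> - F z \<omega>) \<le> 2 * B \<omega> / r * norm (w - z)"
      proof (rule field_differentiable_bound[where S="ball z (r/2)" and f="\<lambda>w. F w \<omega>" and f'="deriv (\<lambda>w. F w \<omega>)"])
        show "((\<lambda>w. F w \<omega>) has_field_derivative deriv (\<lambda>w. F w \<omega>) v) (at v within ball z (r/2))"
          if "v \<in> ball z (r/2)" for v
          using that r
          by (intro has_field_derivative_at_within[OF holomorphic_derivI[OF holr(1)[OF \<omega>]]]) auto
        show "norm (deriv (\<lambda>w. F w \<omega>) v) \<le> 2 * B \<omega> / r" if "v \<in> ball z (r/2)" for v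
          by (rule deriv_bound[OF that])
      qed (use w r in simp_all)
      then show ?thesis
        using w unfolding q_def norm_divide by (intro mult_imp_div_pos_le) simp_all
    qed
    have q_lim: "((\<lambda>w. q w \<omega>) \<longlongrightarrow> D \<omega>) (at z)" if "\<omega> \<in> space M" for \<omega>
    proof -
      have "((\<lambda>w. F w \<omega>) has_field_derivative D \<omega>) (at z)"
        unfolding D_def using holr(1)[OF that] r by (intro holomorphic_derivI[where S="ball z r"]) auto
      then show ?thesis unfolding q_def has_field_derivative_iff .
    qed
    \<comment> \<open>Limits are taken along sequences to fit dominated convergence, and inside the
      half-radius ball so that \<open>q_bound\<close> holds for every term.\<close>
    have "((\<lambda>w. LINT \<omega>|M. q w \<omega>) \<longlongrightarrow> (LINT \<omega>|M. D \<omega>)) (at z within ball z (r/2))"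
      unfolding tendsto_at_iff_sequentially
    proof (intro allI impI)
      fix X :: "nat \<Rightarrow> complex" assume X: "\<forall>i. X i \<in> ball z (r/2) - {z}" "X \<longlonglongrightarrow> z"
      have lim: "(\<lambda>i. q (X i) \<omega>) \<longlonglongrightarrow> D \<omega>" if "\<omega> \<in> space M" for \<omega>
      proof (rule filterlim_compose[OF q_lim[OF that]])
        show "filterlim X (at z) sequentially"
          using X by (auto simp: filterlim_at)
      qed
      have qm: "q (X i) \<in> borel_measurable M" for i
        unfolding q_def using X(1) r sub z
        by (intro borel_measurable_divide borel_measurable_diff meas borel_measurable_const)
          (auto simp: subset_iff dest!: spec[of _ i])
      have Dm: "D \<in> borel_measurable M"
        by (rule borel_measurable_LIMSEQ_metric[where f="\<lambda>i. q (X i)", OF qm lim])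
      show "((\<lambda>w. LINT \<omega>|M. q w \<omega>) \<circ> X) \<longlonglongrightarrow> (LINT \<omega>|M. D \<omega>)"
        unfolding o_def
      proof (rule integral_dominated_convergence[where w="\<lambda>\<omega>. 2 * B \<omega> / r"])
        show "integrable M (\<lambda>\<omega>. 2 * B \<omega> / r)" using B by auto
        show "AE \<omega> in M. norm (q (X i) \<omega>) \<le> 2 * B \<omega> / r" for i
          using X(1) q_bound by (intro AE_I2) auto
      qed (use lim qm Dm in auto)
    qed
    then have "((\<lambda>w. LINT \<omega>|M. q w \<omega>) \<longlongrightarrow> (LINT \<omega>|M. D \<omega>)) (at z)"
      using r by (simp add: at_within_open[of z "ball z (r/2)"])
    then have "((\<lambda>w. ((LINT \<omega>|M. F w \<omega>) - (LINT \<omega>|M. F z \<omega>)) / (w - z)) \<longlongrightarrow> (LINT \<omega>|M. D \<omega>)) (at z)"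
    proof (rule Lim_transform_eventually)
      have "\<forall>\<^sub>F w in at z. w \<in> ball z r"
        using r by (intro eventually_at_in_open') auto
      then show "\<forall>\<^sub>F w in at z. (LINT \<omega>|M. q w \<omega>) = ((LINT \<omega>|M. F w \<omega>) - (LINT \<omega>|M. F z \<omega>)) / (w - z)"
      proof eventually_elim
        case (elim w)
        then show ?case
          using int[of w] int[of z] r by (simp add: q_def)
      qed
    qed
    then show ?thesis
      unfolding field_differentiable_def has_field_derivative_iff by blast
  qed
  then show ?thesis
    by (simp add: holomorphic_on_def field_differentiable_at_within)
qed

section \<open>Exponential moments determine a boundedly supported function\<close>

lemma integrable_mult_continuous_if_bounded_support:
  fixes h u :: "'a::euclidean_space \<Rightarrow> real"
  assumes h: "integrable lborel h" and supp: "\<And>x. x \<notin> cball 0 \<rho> \<Longrightarrow> h x = 0"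
    and u: "continuous_on UNIV u"
  shows "integrable lborel (\<lambda>x. h x * u x)"
proof -
  have [measurable]: "h \<in> borel_measurable borel" using h by simp
  have [measurable]: "u \<in> borel_measurable borel"
    using u by (rule borel_measurable_continuous_onI)
  have "compact (u ` cball 0 \<rho>)"
    using continuous_on_subset[OF u] by (intro compact_continuous_image) auto
  then obtain B where "\<forall>y\<in>u ` cball 0 \<rho>. norm y \<le> B"
    using compact_imp_bounded bounded_iff by metis
  then have B: "\<And>x. x \<in> cball 0 \<rho> \<Longrightarrow> \<bar>u x\<bar> \<le> B" by auto
  have "\<bar>h x * u x\<bar> \<le> \<bar>h x * B\<bar>" for x
    using supp[of x] order_trans[OF B[of x] abs_ge_self]
    by (cases "x \<in> cball 0 \<rho>") (simp_all add: abs_mult mult_left_mono)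
  then show ?thesis
    by (intro Bochner_Integration.integrable_bound[OF integrable_mult_left[OF h, of B]] AE_I2) simp_all
qed

text \<open>The linear span of the real exponentials. It is an algebra because frequencies add under
  multiplication, which is what Stone-Weierstrass requires.\<close>

inductive exp_sum :: "('a::euclidean_space \<Rightarrow> real) \<Rightarrow> bool" where
  exp_sum_single: "exp_sum (\<lambda>x. c * exp (p \<bullet> x))"
| exp_sum_add: "exp_sum u \<Longrightarrow> exp_sum v \<Longrightarrow> exp_sum (\<lambda>x. u x + v x)"

lemma exp_sum_mult_single: "exp_sum v \<Longrightarrow> exp_sum (\<lambda>x. (c * exp (p \<bullet> x)) * v x)"
proof (induction rule: exp_sum.induct)
  case (exp_sum_single d q)
  have "(\<lambda>x. c * exp (p \<bullet> x) * (d * exp (q \<bullet> x))) = (\<lambda>x. (c * d) * exp ((p + q) \<bullet> x))"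
    by (auto simp: inner_add_left exp_add)
  then show ?case using exp_sum.exp_sum_single by metis
next
  case (exp_sum_add u v)
  then show ?case using exp_sum.exp_sum_add by (simp add: distrib_left)
qed

lemma exp_sum_mult: "exp_sum u \<Longrightarrow> exp_sum v \<Longrightarrow> exp_sum (\<lambda>x. u x * v x)"
proof (induction rule: exp_sum.induct)
  case (exp_sum_add u w)
  then show ?case using exp_sum.exp_sum_add by (simp add: distrib_right)
qed (rule exp_sum_mult_single)

lemma exp_sum_continuous: "exp_sum u \<Longrightarrow> continuous_on S u"
  by (induction rule: exp_sum.induct) (auto intro!: continuous_intros)

text \<open>Vanishing moments pass from exponentials to their span, by uniform approximation on the
  ball to all continuous functions, then to indicators of closed sets, and finally to all Borel
  sets.\<close>

lemma AE_zero_if_exp_moments_zero: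
  fixes h :: "'a::euclidean_space \<Rightarrow> real"
  assumes h: "integrable lborel h" and supp: "\<And>x. x \<notin> cball 0 \<rho> \<Longrightarrow> h x = 0"
    and moments: "\<And>p. (LINT x|lborel. h x * exp (p \<bullet> x)) = 0"
  shows "AE x in lborel. h x = 0"
proof -
  have [measurable]: "h \<in> borel_measurable borel" using h by simp
  have int: "integrable lborel (\<lambda>x. h x * u x)" if "continuous_on UNIV u" for u
    by (rule integrable_mult_continuous_if_bounded_support[OF h supp that])
  have zero_sum: "(LINT x|lborel. h x * u x) = 0" if "exp_sum u" for u
    using that
  proof (induction rule: exp_sum.induct)
    case (exp_sum_single c p)
    have "(LINT x|lborel. h x * (c * exp (p \<bullet> x))) = c * (LINT x|lborel. h x * exp (p \<bullet> x))"
      by (subst integral_mult_right_zero[symmetric]) (simp add: mult.left_commute)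
    then show ?case using moments by simp
  next
    case (exp_sum_add u v)
    then show ?case
      by (simp add: distrib_left Bochner_Integration.integral_add int exp_sum_continuous)
  qed
  have zero_cont: "(LINT x|lborel. h x * u x) = 0" if u: "continuous_on UNIV u" for u
  proof -
    have "\<bar>LINT x|lborel. h x * u x\<bar> \<le> e * (LINT x|lborel. \<bar>h x\<bar>)" if e: "e > 0" for e
    proof -
      have "\<exists>v. exp_sum v \<and> (\<forall>x\<in>cball 0 \<rho>. \<bar>u x - v x\<bar> < e)"
      proof (rule Stone_Weierstrass_HOL)
        show "exp_sum (\<lambda>x. c)" for c using exp_sum_single[of c 0] by simp
        show "\<exists>f. exp_sum f \<and> f x \<noteq> f y" if "x \<in> cball 0 \<rho> \<and> y \<in> cball 0 \<rho> \<and> x \<noteq> y" for x y :: 'a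
        proof (intro exI conjI)
          \<comment> \<open>The frequency x - y separates x from y, since its two exponents differ
            by |x - y|^2.\<close>
          show "exp_sum (\<lambda>z. 1 * exp ((x - y) \<bullet> z))" by (rule exp_sum_single)
          have "(x - y) \<bullet> x - (x - y) \<bullet> y = (norm (x - y))\<^sup>2"
            by (simp add: power2_norm_eq_inner inner_diff_right)
          then show "1 * exp ((x - y) \<bullet> x) \<noteq> 1 * exp ((x - y) \<bullet> y)" using that by auto
        qed
      qed (use e u in \<open>auto intro: exp_sum_add exp_sum_mult exp_sum_continuous continuous_on_subset\<close>)
      then obtain v where v: "exp_sum v" "\<And>x. x \<in> cball 0 \<rho> \<Longrightarrow> \<bar>u x - v x\<bar> < e" by blast
      have cv: "continuous_on UNIV v" using v(1) by (rule exp_sum_continuous)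
      have "(LINT x|lborel. h x * u x) = (LINT x|lborel. h x * u x - h x * v x)"
        using zero_sum[OF v(1)] int[OF u] int[OF cv] by simp
      also have "\<bar>\<dots>\<bar> \<le> (LINT x|lborel. \<bar>h x * u x - h x * v x\<bar>)"
        by (rule integral_abs_bound)
      also have "\<dots> \<le> (LINT x|lborel. e * \<bar>h x\<bar>)"
      proof (rule integral_mono)
        show "integrable lborel (\<lambda>x. \<bar>h x * u x - h x * v x\<bar>)" using int[OF u] int[OF cv] by simp
        show "integrable lborel (\<lambda>x. e * \<bar>h x\<bar>)" using h by simp
        show "\<bar>h x * u x - h x * v x\<bar> \<le> e * \<bar>h x\<bar>" for x
        proof (cases "x \<in> cball 0 \<rho>")
          case True
          then have "\<bar>h x\<bar> * \<bar>u x - v x\<bar> \<le> \<bar>h x\<bar> * e" using v(2) by (intro mult_left_mono) (auto intro: less_imp_le)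
          then show ?thesis by (simp add: abs_mult[symmetric] right_diff_distrib mult.commute)
        qed (simp add: supp)
      qed
      finally show ?thesis by simp
    qed
    then have "\<forall>\<^sub>F e in at_right (0::real). \<bar>LINT x|lborel. h x * u x\<bar> \<le> e * (LINT x|lborel. \<bar>h x\<bar>)"
      by (auto simp: eventually_at_filter)
    moreover have "((\<lambda>e. e * (LINT x|lborel. \<bar>h x\<bar>)) \<longlongrightarrow> 0 * (LINT x|lborel. \<bar>h x\<bar>)) (at_right 0)"
      by (intro tendsto_intros)
    ultimately have "\<bar>LINT x|lborel. h x * u x\<bar> \<le> 0 * (LINT x|lborel. \<bar>h x\<bar>)"
      by (intro tendsto_lowerbound[of _ _ "at_right (0::real)"]) auto
    then show ?thesis by simp
  qed
  have closed: "(LINT x|lborel. h x * indicator C x) = 0" if C: "closed C" for C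
  \<comment> \<open>The empty set is treated apart: \<open>infdist\<close> to it is 0 by convention,
    so the cut-offs below would be constantly 1.\<close>
  proof (cases "C = {}")
    case False
    \<comment> \<open>Continuous cut-offs equal to 1 on \<open>C\<close> that, for n > 0, vanish at
      distance 1/n and beyond; closedness of \<open>C\<close> makes them converge to its
      indicator.\<close>
    define u where "u n x = max 0 (1 - real n * infdist x C)" for n x
    have cont_u: "continuous_on UNIV (u n)" for n
      unfolding u_def by (intro continuous_intros)
    have "(\<lambda>n. LINT x|lborel. h x * u n x) \<longlonglongrightarrow> (LINT x|lborel. h x * indicator C x)"
    proof (rule integral_dominated_convergence[where w="\<lambda>x. \<bar>h x\<bar>"])
      have [measurable]: "C \<in> sets borel" using C by simp
      show "(\<lambda>x. h x * indicator C x) \<in> borel_measurable lborel" by measurable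
      show "(\<lambda>x. h x * u n x) \<in> borel_measurable lborel" for n
        using borel_measurable_continuous_onI[OF cont_u] by (intro borel_measurable_times) auto
      show "AE x in lborel. norm (h x * u n x) \<le> \<bar>h x\<bar>" for n
        by (intro AE_I2) (auto simp: u_def abs_mult infdist_nonneg intro!: mult_left_le)
      show "AE x in lborel. (\<lambda>n. h x * u n x) \<longlonglongrightarrow> h x * indicator C x"
      proof (intro AE_I2 tendsto_mult tendsto_const)
        fix x
        show "(\<lambda>n. u n x) \<longlonglongrightarrow> indicator C x"
        proof (cases "x \<in> C")
          case True
          then show ?thesis by (simp add: u_def)
        next
          case x: False
          then have "infdist x C > 0"
            using C False infdist_nonneg[of x C] in_closed_iff_infdist_zero[of C x] by (auto simp: less_le)
          then obtain N where "1 < real N * infdist x C" using ex_less_of_nat_mult by blast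
          then have "1 \<le> real n * infdist x C" if "n \<ge> N" for n
            using that infdist_nonneg[of x C]
            by (meson less_imp_le mult_right_mono of_nat_mono order_trans)
          then have "\<forall>\<^sub>F n in sequentially. u n x = 0"
            unfolding u_def by (intro eventually_sequentiallyI[of N]) auto
          then show ?thesis using x by (simp add: tendsto_eventually)
        qed
      qed
    qed (use h in auto)
    moreover have "(LINT x|lborel. h x * u n x) = 0" for n
      by (rule zero_cont[OF cont_u])
    ultimately show ?thesis by (simp add: LIMSEQ_const_iff)
  qed simp
  have total: "(LINT x|lborel. h x) = 0" using moments[of 0] by simp
  \<comment> \<open>Dynkin's argument on the intersection-stable family of closed sets. Complements
    use that the total integral, the moment at p = 0, vanishes.\<close>
  have sets_zero: "(LINT x|lborel. h x * indicator A x) = 0" if "A \<in> sets borel" for A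
  proof -
    have gen: "sets (borel::'a measure) = sigma_sets UNIV (Collect closed)"
      by (subst borel_eq_closed) (simp add: sets_measure_of)
    have "Int_stable (Collect (closed :: 'a set \<Rightarrow> bool))" by (auto simp: Int_stable_def)
    moreover have "Collect closed \<subseteq> Pow (UNIV :: 'a set)" by simp
    moreover have "A \<in> sigma_sets UNIV (Collect closed)" using that gen by blast
    ultimately show ?thesis
    proof (induction rule: sigma_sets_induct_disjoint)
      case (compl A)
      then have [measurable]: "A \<in> sets borel" using gen by blast
      have "(LINT x|lborel. h x * indicator (UNIV - A) x) = (LINT x|lborel. h x - h x * indicator A x)"
        by (intro Bochner_Integration.integral_cong) (auto simp: indicator_def)
      also have "\<dots> = 0"
        using compl h integrable_mult_indicator[of A lborel h] total
        by (subst Bochner_Integration.integral_diff) (auto simp: mult.commute)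
      finally show ?case .
    next
      case (union A)
      then have [measurable]: "A i \<in> sets borel" for i using gen by blast
      have "(LINT x:(\<Union>i. A i)|lborel. h x) = (\<Sum>i. (LINT x:(A i)|lborel. h x))"
        using union(1) h integrable_mult_indicator[of "\<Union>i. A i" lborel h]
        by (intro lebesgue_integral_countable_add) (auto simp: disjoint_family_on_def set_integrable_def)
      then show ?case
        using union(3) by (simp add: set_lebesgue_integral_def mult.commute)
    qed (use closed in auto)
  qed
  show ?thesis
  proof (rule density_unique_real[of lborel h "\<lambda>_. 0"])
    fix A :: "'a set" assume "A \<in> sets lborel"
    then show "(LINT x:A|lborel. h x) = (LINT x:A|lborel. 0)"
      using sets_zero[of A] by (simp add: set_lebesgue_integral_def mult.commute)
  qed (use h in auto)
qed

section \<open>Heat potentials of moving sources\<close>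

text \<open>The kernel is a Gaussian with variance 2 t in each coordinate, so its total mass follows
  from one-dimensional normal densities.\<close>

lemma heat_kernel_eq_prod:
  assumes t: "t > 0"
  shows "heat_kernel x t = (\<Prod>b\<in>Basis. normal_density 0 (sqrt (2 * t)) (x \<bullet> b))"
proof -
  have nd: "normal_density 0 (sqrt (2 * t)) r = 1 / sqrt (4 * pi * t) * exp (- r\<^sup>2 / (4 * t))" for r
    using t by (simp add: normal_density_def)
  have "(\<Prod>b\<in>(Basis::(real^3) set). normal_density 0 (sqrt (2 * t)) (x \<bullet> b))
      = (\<Prod>b\<in>(Basis::(real^3) set). 1 / sqrt (4 * pi * t)) * (\<Prod>b\<in>Basis. exp (- (x \<bullet> b)\<^sup>2 / (4 * t)))"
    unfolding nd by (rule prod.distrib)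
  also have "(\<Prod>b\<in>Basis. exp (- (x \<bullet> b)\<^sup>2 / (4 * t))) = exp (\<Sum>b\<in>Basis. - (x \<bullet> b)\<^sup>2 / (4 * t))"
    by (simp add: exp_sum)
  also have "(\<Sum>b\<in>Basis. - (x \<bullet> b)\<^sup>2 / (4 * t)) = - (norm x)\<^sup>2 / (4 * t)"
    by (simp add: sum_divide_distrib[symmetric] sum_negf power2_norm_eq_inner euclidean_inner[of x x] flip: power2_eq_square)
  also have "(\<Prod>b\<in>(Basis::(real^3) set). 1 / sqrt (4 * pi * t)) = 1 / (4 * pi * t) powr (3/2)"
    using t by (simp add: powr_half_sqrt[symmetric] powr_powr power_divide powr_power)
  finally show ?thesis by (simp add: heat_kernel_def)
qed

lemma heat_kernel_nonneg: "heat_kernel x t \<ge> 0"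
  by (simp add: heat_kernel_def)

lemma borel_measurable_heat_kernel [measurable (raw)]:
  assumes [measurable]: "u \<in> borel_measurable M" "v \<in> borel_measurable M"
  shows "(\<lambda>x. heat_kernel (u x) (v x)) \<in> borel_measurable M"
  unfolding heat_kernel_def by measurable

lemma has_bochner_integral_heat_kernel:
  assumes t: "t > 0"
  shows "has_bochner_integral lborel (\<lambda>x. heat_kernel x t) 1"
proof (rule has_bochner_integral_nn_integral)
  have "(\<integral>\<^sup>+x. ennreal (heat_kernel x t) \<partial>lborel)
      = (\<integral>\<^sup>+x. (\<Prod>b\<in>(Basis::(real^3) set). ennreal (normal_density 0 (sqrt (2 * t)) (x \<bullet> b))) \<partial>lborel)"
    by (simp add: heat_kernel_eq_prod[OF t] prod_ennreal)
  also have "\<dots> = (\<Prod>b\<in>(Basis::(real^3) set). (\<integral>\<^sup>+x. ennreal (normal_density 0 (sqrt (2 * t)) x) \<partial>lborel))"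
    by (intro nn_integral_lborel_prod) auto
  also have "\<dots> = 1"
    using t by (subst nn_integral_eq_integral) auto
  finally show "(\<integral>\<^sup>+x. ennreal (heat_kernel x t) \<partial>lborel) = ennreal 1" by simp
qed (auto simp: heat_kernel_nonneg)

lemma has_bochner_integral_lborel_translate:
  fixes f :: "'a::euclidean_space \<Rightarrow> 'b::{banach, second_countable_topology}"
  assumes "has_bochner_integral lborel f I"
  shows "has_bochner_integral lborel (\<lambda>x. f (x - c)) I"
proof -
  have f: "integrable lborel f" "integral\<^sup>L lborel f = I"
    using assms by (auto simp: has_bochner_integral_iff)
  have "integrable (distr lborel borel ((+) (- c))) f" "integral\<^sup>L (distr lborel borel ((+) (- c))) f = I"
    unfolding lborel_distr_plus using f by auto
  then show ?thesis
    using f(1) by (subst (asm) integrable_distr_eq, simp, simp)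
      (subst (asm) integral_distr, auto simp: has_bochner_integral_iff)
qed

text \<open>Completing the square moves the centre of the Gaussian from y to y + 2 t p and leaves
  the stated constant as a factor.\<close>

lemma has_bochner_integral_heat_kernel_exp:
  assumes t: "t > 0"
  shows "has_bochner_integral lborel (\<lambda>x. heat_kernel (x - y) t * exp (p \<bullet> x))
           (exp (p \<bullet> y + t * (norm p)\<^sup>2))"
proof -
  have sq: "- (norm (x - y))\<^sup>2 / (4 * t) + p \<bullet> x
      = - (norm (x - (y + (2 * t) *\<^sub>R p)))\<^sup>2 / (4 * t) + (p \<bullet> y + t * (norm p)\<^sup>2)" for x
    using t by (simp add: power2_norm_eq_inner inner_diff_left inner_diff_right inner_add_left inner_add_right
        inner_commute field_simps)
  have eq: "heat_kernel (x - y) t * exp (p \<bullet> x)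
      = exp (p \<bullet> y + t * (norm p)\<^sup>2) * heat_kernel (x - (y + (2 * t) *\<^sub>R p)) t" for x
    using sq[of x] by (simp add: heat_kernel_def exp_add[symmetric] mult.commute mult.left_commute)
  have "has_bochner_integral lborel (\<lambda>x. heat_kernel (x - (y + (2 * t) *\<^sub>R p)) t) 1"
    by (intro has_bochner_integral_lborel_translate has_bochner_integral_heat_kernel t)
  then have "has_bochner_integral lborel
      (\<lambda>x. exp (p \<bullet> y + t * (norm p)\<^sup>2) * heat_kernel (x - (y + (2 * t) *\<^sub>R p)) t)
      (exp (p \<bullet> y + t * (norm p)\<^sup>2) * 1)"
    by (intro has_bochner_integral_mult_right)
  then show ?thesis by (simp add: eq)
qed

section \<open>Heat potentials and their exponential transforms\<close>

lemma integrable_lborel_prod_mult: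
  fixes u :: "'a::euclidean_space \<Rightarrow> real" and v :: "'b::euclidean_space \<Rightarrow> real"
  assumes u: "integrable lborel u" and v: "integrable lborel v"
  shows "integrable (lborel \<Otimes>\<^sub>M lborel) (\<lambda>(s, z). u s * v z)"
proof (rule lborel_pair.Fubini_integrable)
  have [measurable]: "u \<in> borel_measurable borel" "v \<in> borel_measurable borel"
    using u v by auto
  show "(\<lambda>(s, z). u s * v z) \<in> borel_measurable (lborel \<Otimes>\<^sub>M lborel)" by measurable
  show "integrable lborel (\<lambda>s. LINT z|lborel. norm (case (s, z) of (s, z) \<Rightarrow> u s * v z))"
    using u by (simp add: abs_mult)
qed (use v in auto)

text \<open>Duhamel's formula at time \<open>T\<close> after the substitution y = a(s) + z, which
  moves the orbit from the source into the kernel. The endpoint s = T, where the kernel is singular,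
  is cut off.\<close>

definition heat_potential ::
    "real \<Rightarrow> (real^3 \<Rightarrow> real) \<Rightarrow> (real \<Rightarrow> real) \<Rightarrow> (real \<Rightarrow> real^3) \<Rightarrow> real^3 \<Rightarrow> real" where
  "heat_potential T f g a x = (LINT s|lborel. LINT z|lborel.
     indicator {0..<T} s * g s * f z * heat_kernel (x - (a s + z)) (T - s))"

text \<open>The factor depending on the orbit in the exponential transform of the potential.\<close>

definition orbit_transform ::
    "real \<Rightarrow> (real \<Rightarrow> real) \<Rightarrow> (real \<Rightarrow> real^3) \<Rightarrow> real^3 \<Rightarrow> real" where
  "orbit_transform T g a p =
     (LINT s|lborel. indicator {0..<T} s * g s * exp (p \<bullet> a s + (T - s) * (norm p)\<^sup>2))"

lemma integrable_indicator_continuous: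
  fixes g :: "real \<Rightarrow> real"
  assumes g: "continuous_on UNIV g"
  shows "integrable lborel (\<lambda>s. indicator {0..<T} s * g s)"
proof -
  have "integrable lborel (\<lambda>s. (indicator {0..<T} s :: real) * g s)"
  proof (rule integrable_mult_continuous_if_bounded_support[where \<rho>="\<bar>T\<bar>"])
    show "integrable lborel (indicator {0..<T} :: real \<Rightarrow> real)"
      by (intro integrable_real_indicator emeasure_bounded_finite) auto
  qed (use g in \<open>auto simp: indicator_def\<close>)
  then show ?thesis .
qed

text \<open>Integrating over x first replaces the kernel by exp (p . (a(s) + z) + (T - s) |p|^2),
  which separates the variables s and z. The same computation with absolute values justifies
  Fubini.\<close>

lemma heat_potential_exp_transform:
  fixes f :: "real^3 \<Rightarrow> real"
  assumes f: "integrable lborel f" and supp: "\<And>z. z \<notin> cball 0 \<rho> \<Longrightarrow> f z = 0"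
    and g: "continuous_on UNIV g" and a: "continuous_on UNIV a"
  shows "(LINT x|lborel. exp (p \<bullet> x) * heat_potential T f g a x)
       = (LINT z|lborel. f z * exp (p \<bullet> z)) * orbit_transform T g a p"
proof -
  have [measurable]: "f \<in> borel_measurable borel" "g \<in> borel_measurable borel" "a \<in> borel_measurable borel"
    using f g a by (auto intro: borel_measurable_continuous_onI)
  define u where "u s = indicator {0..<T} s * (g s * exp (p \<bullet> a s + (T - s) * (norm p)\<^sup>2))" for s
  define v where "v z = f z * exp (p \<bullet> z)" for z
  have u: "integrable lborel u"
    unfolding u_def by (intro integrable_indicator_continuous continuous_intros g a)
  have v: "integrable lborel v"
    unfolding v_def
    by (intro integrable_mult_continuous_if_bounded_support[OF f supp] continuous_intros)
  define k where "k = (\<lambda>(s, z) x. indicator {0..<T} s * g s * f z * heat_kernel (x - (a s + z)) (T - s) * exp (p \<bullet> x))"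
  have hk: "has_bochner_integral lborel (\<lambda>x. c * heat_kernel (x - (a s + z)) (T - s) * exp (p \<bullet> x))
      (c * exp (p \<bullet> (a s + z) + (T - s) * (norm p)\<^sup>2))" if "s < T" for s z c
    unfolding mult.assoc using that
    by (intro has_bochner_integral_mult_right has_bochner_integral_heat_kernel_exp) simp
  have k_x: "has_bochner_integral lborel (\<lambda>x. k (s, z) x) (u s * v z)"
    and k_abs: "has_bochner_integral lborel (\<lambda>x. norm (k (s, z) x)) \<bar>u s * v z\<bar>" for s z
  proof -
    have *: "u s * v z = (indicator {0..<T} s * g s * f z) * exp (p \<bullet> (a s + z) + (T - s) * (norm p)\<^sup>2)"
      by (simp add: u_def v_def exp_add inner_add_right)
    have "has_bochner_integral lborel (\<lambda>x. k (s, z) x) (u s * v z)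
        \<and> has_bochner_integral lborel (\<lambda>x. norm (k (s, z) x)) \<bar>u s * v z\<bar>"
    proof (cases "s < T")
      case True
      then show ?thesis
        using hk[OF True, of "indicator {0..<T} s * g s * f z" z] hk[OF True, of "\<bar>indicator {0..<T} s * g s * f z\<bar>" z]
        unfolding * by (simp add: k_def abs_mult heat_kernel_nonneg)
    qed (simp add: k_def u_def has_bochner_integral_iff)
    then show "has_bochner_integral lborel (\<lambda>x. k (s, z) x) (u s * v z)"
      "has_bochner_integral lborel (\<lambda>x. norm (k (s, z) x)) \<bar>u s * v z\<bar>" by auto
  qed
  interpret P: pair_sigma_finite "lborel \<Otimes>\<^sub>M lborel :: (real \<times> (real^3)) measure" "lborel :: (real^3) measure"
    unfolding lborel_prod ..
  have int_k: "integrable ((lborel \<Otimes>\<^sub>M lborel) \<Otimes>\<^sub>M lborel) (case_prod k)"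
  proof (rule P.Fubini_integrable)
    show "case_prod k \<in> borel_measurable ((lborel \<Otimes>\<^sub>M lborel) \<Otimes>\<^sub>M lborel)"
      unfolding k_def case_prod_unfold by measurable
    have "(\<lambda>sz. LINT x|lborel. norm (case_prod k (sz, x))) = (\<lambda>(s, z). \<bar>u s\<bar> * \<bar>v z\<bar>)"
      using k_abs by (auto simp: has_bochner_integral_iff abs_mult)
    then show "integrable (lborel \<Otimes>\<^sub>M lborel) (\<lambda>sz. LINT x|lborel. norm (case_prod k (sz, x)))"
      using integrable_lborel_prod_mult[of "\<lambda>s. \<bar>u s\<bar>" "\<lambda>z. \<bar>v z\<bar>"] u v by simp
    show "AE sz in lborel \<Otimes>\<^sub>M lborel. integrable lborel (\<lambda>x. case_prod k (sz, x))"
      using k_x by (intro AE_I2) (auto simp: has_bochner_integral_iff)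
  qed
  have pot: "exp (p \<bullet> x) * heat_potential T f g a x = (LINT s|lborel. LINT z|lborel. k (s, z) x)" for x
    unfolding heat_potential_def k_def by (simp add: mult.commute)
  have "(LINT x|lborel. exp (p \<bullet> x) * heat_potential T f g a x)
      = (LINT x|lborel. LINT sz|(lborel \<Otimes>\<^sub>M lborel). k sz x)"
  \<comment> \<open>Fubini identifies the iterated integral with the one over the product only for
    almost every x.\<close>
  proof (rule integral_cong_AE)
    show "(\<lambda>x. exp (p \<bullet> x) * heat_potential T f g a x) \<in> borel_measurable lborel"
      unfolding heat_potential_def by measurable
    show "(\<lambda>x. LINT sz|(lborel \<Otimes>\<^sub>M lborel). k sz x) \<in> borel_measurable lborel"
      using P.integrable_snd[OF int_k] by auto
    show "AE x in lborel. exp (p \<bullet> x) * heat_potential T f g a x = (LINT sz|(lborel \<Otimes>\<^sub>M lborel). k sz x)"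
      using P.AE_integrable_snd[OF int_k]
    proof eventually_elim
      case (elim x)
      then show ?case
        unfolding pot using lborel_pair.integral_fst'[of "\<lambda>sz. k sz x"] by simp
    qed
  qed
  also have "\<dots> = (LINT sz|(lborel \<Otimes>\<^sub>M lborel). LINT x|lborel. k sz x)"
    by (rule P.Fubini_integral[OF int_k])
  also have "\<dots> = (LINT sz|(lborel \<Otimes>\<^sub>M lborel). (\<lambda>(s, z). u s * v z) sz)"
    using k_x by (intro Bochner_Integration.integral_cong) (auto simp: has_bochner_integral_iff)
  also have "\<dots> = (LINT s|lborel. LINT z|lborel. u s * v z)"
    using lborel_pair.integral_fst[OF integrable_lborel_prod_mult[OF u v]] by simp
  also have "\<dots> = (LINT z|lborel. f z * exp (p \<bullet> z)) * orbit_transform T g a p"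
  proof -
    have "(LINT s|lborel. LINT z|lborel. u s * v z) = integral\<^sup>L lborel v * integral\<^sup>L lborel u"
      by simp
    moreover have "orbit_transform T g a p = integral\<^sup>L lborel u"
      by (simp add: orbit_transform_def u_def[abs_def] mult.assoc)
    ultimately show ?thesis by (simp add: v_def[abs_def])
  qed
  finally show ?thesis .
qed

text \<open>The bound is uniform in \<open>t\<close>, which tames the singularity of the heat kernel at \<open>s = T\<close>.\<close>

lemma gaussian_decay_bound:
  fixes c t :: real
  assumes c: "c > 0" and t: "t > 0"
  shows "1 / (4 * pi * t) powr (3/2) * exp (- c / t) \<le> 1 / (8 * pi * c / 3) powr (3/2)"
proof -
  \<comment> \<open>This is y \<le> exp y at y = 2 c / (3 t); the power 3/2 then turns the right
    side into exp (c / t).\<close>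
  have "2 * c / (3 * t) \<le> exp (2 * c / (3 * t))"
    using exp_ge_add_one_self[of "2 * c / (3 * t)"] by linarith
  then have "(2 * c / (3 * t)) powr (3/2) \<le> exp (2 * c / (3 * t)) powr (3/2)"
    using c t by (intro powr_mono2) auto
  also have "\<dots> = exp (c / t)" by (simp add: exp_powr_real)
  finally have *: "(2 * c / (3 * t)) powr (3/2) \<le> exp (c / t)" .
  have "(8 * pi * c / 3) powr (3/2) = (4 * pi * t) powr (3/2) * (2 * c / (3 * t)) powr (3/2)"
    using c t by (subst powr_mult[symmetric]) (simp_all add: mult.assoc)
  also have "\<dots> \<le> (4 * pi * t) powr (3/2) * exp (c / t)"
    using * by (intro mult_left_mono) auto
  finally have "(8 * pi * c / 3) powr (3/2) \<le> (4 * pi * t) powr (3/2) * exp (c / t)" .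
  then show ?thesis
    using c t by (simp add: exp_minus field_simps)
qed

text \<open>In the kernel, |r \<omega> - y|^2 with y = a(s) + z is a quadratic polynomial in r, and
  r may be made complex. Since |y| \<le> R0, its real part at \<zeta> is at least (Re \<zeta> -
  |y|)^2 - (Im \<zeta>)^2, which is positive on the cone, so the Gaussian still decays
  there.\<close>

lemma heat_potential_radial_extension:
  fixes f :: "real^3 \<Rightarrow> real" and \<omega> :: "real^3"
  assumes f: "integrable lborel f" and supp: "\<And>z. z \<notin> cball 0 R1 \<Longrightarrow> f z = 0"
    and g: "continuous_on UNIV g" and a: "continuous_on UNIV a"
    and a_bound: "\<And>s. s \<in> {0..<T} \<Longrightarrow> norm (a s) \<le> R2"
    and \<omega>: "norm \<omega> = 1" and R0: "R0 = R1 + R2" "R0 \<ge> 0"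
  shows "\<exists>\<Psi>. \<Psi> holomorphic_on {z. Re z > R0 + \<bar>Im z\<bar>} \<and>
           (\<forall>r>R0. \<Psi> (of_real r) = of_real (heat_potential T f g a (r *\<^sub>R \<omega>)))"
proof -
  have [measurable]: "f \<in> borel_measurable borel" "g \<in> borel_measurable borel" "a \<in> borel_measurable borel"
    using f g a by (auto intro: borel_measurable_continuous_onI)
  define w where "w = (\<lambda>(s, z). (indicator {0..<T} s * g s) * f z)"
  define c where "c = (\<lambda>(s, z). w (s, z) * (1 / (4 * pi * (T - s)) powr (3/2)))"
  define q where "q \<zeta> = (\<lambda>(s, z). \<zeta>\<^sup>2 - 2 * \<zeta> * of_real (\<omega> \<bullet> (a s + z)) + of_real ((norm (a s + z))\<^sup>2))"
    for \<zeta> :: complex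
  define F where "F \<zeta> = (\<lambda>(s, z). of_real (c (s, z)) * exp (- q \<zeta> (s, z) / of_real (4 * (T - s))))"
    for \<zeta> :: complex
  define \<Omega> where "\<Omega> = {z. Re z > R0 + \<bar>Im z\<bar>}"
  have int_w: "integrable (lborel \<Otimes>\<^sub>M lborel) w"
    unfolding w_def by (intro integrable_lborel_prod_mult integrable_indicator_continuous g f)
  have meas: "F \<zeta> \<in> borel_measurable (lborel \<Otimes>\<^sub>M lborel)" for \<zeta>
    unfolding F_def c_def w_def q_def by measurable
  \<comment> \<open>Here \<open>\<delta>\<close> measures depth inside the cone and gives Re q \<ge>
    \<delta>^2. The constant is that of \<open>gaussian_decay_bound\<close> with c = \<delta>^2 /
    4.\<close>
  have bound: "norm (F \<zeta> (s, z)) \<le> \<bar>w (s, z)\<bar> * (1 / (8 * pi * (\<delta>\<^sup>2 / 4) / 3) powr (3/2))"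
    if \<zeta>: "Re \<zeta> \<ge> R0 + \<bar>Im \<zeta>\<bar> + \<delta>" and \<delta>: "\<delta> > 0" for \<zeta> s z \<delta>
  proof (cases "w (s, z) = 0")
    case True
    then show ?thesis by (simp add: F_def c_def)
  next
    case False
    then have s: "s \<in> {0..<T}" and z: "norm z \<le> R1"
      using supp[of z] by (auto simp: w_def indicator_def split: if_splits)
    define y where "y = a s + z"
    have y: "norm y \<le> R0"
      unfolding y_def using norm_triangle_ineq[of "a s" z] a_bound[OF s] z R0 by linarith
    have "\<omega> \<bullet> y \<le> norm y" using norm_cauchy_schwarz[of \<omega> y] \<omega> by simp
    moreover have "Re \<zeta> \<ge> 0" using \<zeta> \<delta> R0 by linarith
    ultimately have "Re \<zeta> * (\<omega> \<bullet> y) \<le> Re \<zeta> * norm y" by (intro mult_left_mono)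
    moreover have "(Re \<zeta> - norm y)\<^sup>2 \<ge> (\<bar>Im \<zeta>\<bar> + \<delta>)\<^sup>2"
      using \<zeta> \<delta> y by (intro power_mono) auto
    moreover have "(\<bar>Im \<zeta>\<bar> + \<delta>)\<^sup>2 \<ge> (Im \<zeta>)\<^sup>2 + \<delta>\<^sup>2"
      using \<delta> by (simp add: power2_sum)
    ultimately have Re_q: "Re (q \<zeta> (s, z)) \<ge> \<delta>\<^sup>2"
      by (simp add: q_def y_def[symmetric] power2_diff Re_power2)
    have "norm (F \<zeta> (s, z)) = \<bar>w (s, z)\<bar> * (1 / (4 * pi * (T - s)) powr (3/2) * exp (- Re (q \<zeta> (s, z)) / (4 * (T - s))))"
    proof -
      have "norm (exp (- q \<zeta> (s, z) / of_real (4 * (T - s)))) = exp (- Re (q \<zeta> (s, z)) / (4 * (T - s)))"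
        by (simp only: norm_exp_eq_Re Re_divide_of_real uminus_complex.sel)
      then have "norm (F \<zeta> (s, z)) = \<bar>c (s, z)\<bar> * exp (- Re (q \<zeta> (s, z)) / (4 * (T - s)))"
        by (simp only: F_def case_prod_conv norm_mult norm_of_real)
      then show ?thesis by (simp add: c_def abs_mult)
    qed
    also have "\<dots> \<le> \<bar>w (s, z)\<bar> * (1 / (4 * pi * (T - s)) powr (3/2) * exp (- (\<delta>\<^sup>2 / 4) / (T - s)))"
    proof -
      have "- Re (q \<zeta> (s, z)) / (4 * (T - s)) \<le> - \<delta>\<^sup>2 / (4 * (T - s))"
        using Re_q s by (intro divide_right_mono) auto
      then show ?thesis by (intro mult_left_mono) auto
    qed
    also have "\<dots> \<le> \<bar>w (s, z)\<bar> * (1 / (8 * pi * (\<delta>\<^sup>2 / 4) / 3) powr (3/2))"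
      using s \<delta> by (intro mult_left_mono gaussian_decay_bound) auto
    finally show ?thesis .
  qed
  define \<Psi> where "\<Psi> \<zeta> = (LINT sz|(lborel \<Otimes>\<^sub>M lborel). F \<zeta> sz)" for \<zeta>
  have "\<Psi> holomorphic_on \<Omega>"
    unfolding \<Psi>_def
  proof (rule integral_holomorphic_dominated)
    show "(\<lambda>\<zeta>. F \<zeta> sz) holomorphic_on \<Omega>" for sz
      unfolding F_def q_def case_prod_beta
      \<comment> \<open>At s = T the quotient is 0 by convention, and the integrand is constant in
        \<open>\<zeta>\<close>.\<close>
      by (cases "T - fst sz = 0") (auto intro!: holomorphic_intros)
  next
    fix \<zeta> assume "\<zeta> \<in> \<Omega>"
    \<comment> \<open>\<open>\<zeta>\<close> has depth 2 \<delta>. Moving by \<delta>/2 changes Re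
      and Im by at most \<delta>/2 each, which leaves depth \<delta>.\<close>
    define \<delta> where "\<delta> = (Re \<zeta> - R0 - \<bar>Im \<zeta>\<bar>) / 2"
    have \<delta>: "\<delta> > 0" using \<open>\<zeta> \<in> \<Omega>\<close> by (simp add: \<delta>_def \<Omega>_def)
    have near: "Re v \<ge> R0 + \<bar>Im v\<bar> + \<delta>" if "v \<in> cball \<zeta> (\<delta> / 2)" for v
    proof -
      have "\<bar>Re (\<zeta> - v)\<bar> \<le> \<delta> / 2" "\<bar>Im (\<zeta> - v)\<bar> \<le> \<delta> / 2"
        using that abs_Re_le_cmod[of "\<zeta> - v"] abs_Im_le_cmod[of "\<zeta> - v"] by (auto simp: dist_norm)
      then have "Re v \<ge> Re \<zeta> - \<delta> / 2" "\<bar>Im v\<bar> \<le> \<bar>Im \<zeta>\<bar> + \<delta> / 2"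
        unfolding minus_complex.sel by linarith+
      moreover have "Re \<zeta> = R0 + \<bar>Im \<zeta>\<bar> + 2 * \<delta>" by (simp add: \<delta>_def field_simps)
      ultimately show ?thesis by linarith
    qed
    show "\<exists>r>0. \<exists>B. integrable (lborel \<Otimes>\<^sub>M lborel) B \<and> cball \<zeta> r \<subseteq> \<Omega> \<and>
        (\<forall>v\<in>cball \<zeta> r. \<forall>sz\<in>space (lborel \<Otimes>\<^sub>M lborel). norm (F v sz) \<le> B sz)"
    proof (intro exI conjI ballI)
      show "\<delta> / 2 > 0" using \<delta> by simp
      show "integrable (lborel \<Otimes>\<^sub>M lborel) (\<lambda>sz. \<bar>w sz\<bar> * (1 / (8 * pi * (\<delta>\<^sup>2 / 4) / 3) powr (3/2)))"
        by (intro integrable_mult_left integrable_abs int_w)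
      show "cball \<zeta> (\<delta> / 2) \<subseteq> \<Omega>" using near \<delta> by (force simp: \<Omega>_def)
      show "norm (F v sz) \<le> \<bar>w sz\<bar> * (1 / (8 * pi * (\<delta>\<^sup>2 / 4) / 3) powr (3/2))"
        if "v \<in> cball \<zeta> (\<delta> / 2)" for v sz
        using bound[OF near[OF that] \<delta>] by (cases sz) auto
    qed
  qed (rule meas)
  moreover have "\<Psi> (of_real r) = of_real (heat_potential T f g a (r *\<^sub>R \<omega>))" if r: "r > R0" for r
  proof -
    define k where "k = (\<lambda>s z. indicator {0..<T} s * g s * f z * heat_kernel (r *\<^sub>R \<omega> - (a s + z)) (T - s))"
    have F_eq: "F (of_real r) (s, z) = of_real (k s z)" for s z
    proof -
      have "q (of_real r) (s, z) = of_real ((norm (r *\<^sub>R \<omega> - (a s + z)))\<^sup>2)"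
        unfolding q_def case_prod_conv power2_norm_eq_inner
        using \<omega> by (simp add: inner_diff_left inner_diff_right inner_commute norm_eq_1 power2_eq_square algebra_simps)
      then show ?thesis
        by (simp add: F_def c_def w_def k_def heat_kernel_def exp_of_real[symmetric])
    qed
    have "integrable (lborel \<Otimes>\<^sub>M lborel) (F (of_real r))"
    proof (rule Bochner_Integration.integrable_bound)
      show "integrable (lborel \<Otimes>\<^sub>M lborel) (\<lambda>sz. \<bar>w sz\<bar> * (1 / (8 * pi * ((r - R0)\<^sup>2 / 4) / 3) powr (3/2)))"
        by (intro integrable_mult_left integrable_abs int_w)
      show "AE sz in lborel \<Otimes>\<^sub>M lborel. norm (F (of_real r) sz)
          \<le> norm (\<bar>w sz\<bar> * (1 / (8 * pi * ((r - R0)\<^sup>2 / 4) / 3) powr (3/2)))"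
        using bound[where \<zeta>="of_real r" and \<delta>="r - R0"] r by (intro AE_I2) (auto simp: abs_mult)
    qed (rule meas)
    then have "integrable (lborel \<Otimes>\<^sub>M lborel) (\<lambda>sz. complex_of_real (case_prod k sz))"
      by (rule Bochner_Integration.integrable_cong[THEN iffD1, rotated -1]) (auto simp: F_eq)
    then have int_k: "integrable (lborel \<Otimes>\<^sub>M lborel) (case_prod k)"
      by (simp add: complex_of_real_integrable_eq)
    have "\<Psi> (of_real r) = (LINT sz|(lborel \<Otimes>\<^sub>M lborel). complex_of_real (case_prod k sz))"
      unfolding \<Psi>_def by (intro Bochner_Integration.integral_cong) (auto simp: F_eq)
    also have "\<dots> = of_real (LINT s|lborel. LINT z|lborel. k s z)"
      using lborel_pair.integral_fst[OF int_k] by simp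
    finally show ?thesis by (simp add: heat_potential_def k_def)
  qed
  ultimately show ?thesis unfolding \<Omega>_def by blast
qed

text \<open>Every point outside the ball lies on a ray from the origin. Along it both potentials
  extend holomorphically to the same convex cone and agree for radii between R1 + R2 and R, hence
  everywhere on the ray beyond R1 + R2.\<close>

lemma heat_potential_eq_everywhere:
  fixes f :: "real^3 \<Rightarrow> real"
  assumes f: "integrable lborel f" and supp: "\<And>z. z \<notin> cball 0 R1 \<Longrightarrow> f z = 0"
    and g: "continuous_on UNIV g" and a: "continuous_on UNIV a" and b: "continuous_on UNIV b"
    and a_bound: "\<And>s. s \<in> {0..<T} \<Longrightarrow> norm (a s) \<le> R2"
    and b_bound: "\<And>s. s \<in> {0..<T} \<Longrightarrow> norm (b s) \<le> R2"
    and R: "R > R1 + R2" "R1 \<ge> 0" "R2 \<ge> 0"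
    and eq: "\<And>x. x \<in> ball 0 R \<Longrightarrow> heat_potential T f g a x = heat_potential T f g b x"
  shows "heat_potential T f g a x = heat_potential T f g b x"
proof (cases "x \<in> ball 0 R")
  case False
  define R0 where "R0 = R1 + R2"
  define r where "r = norm x"
  have r: "r \<ge> R" "r > R0" "r > 0" using False R by (auto simp: r_def R0_def)
  define \<omega> where "\<omega> = x /\<^sub>R r"
  have \<omega>: "norm \<omega> = 1" "x = r *\<^sub>R \<omega>" using r by (auto simp: \<omega>_def r_def)
  define \<Omega> where "\<Omega> = {z. Re z > R0 + \<bar>Im z\<bar>}"
  obtain \<Psi> where \<Psi>: "\<Psi> holomorphic_on \<Omega>"
    "\<And>r. r > R0 \<Longrightarrow> \<Psi> (of_real r) = of_real (heat_potential T f g a (r *\<^sub>R \<omega>))"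
    using heat_potential_radial_extension[OF f supp g a a_bound \<omega>(1) R0_def] R
    unfolding \<Omega>_def R0_def by auto
  obtain \<Theta> where \<Theta>: "\<Theta> holomorphic_on \<Omega>"
    "\<And>r. r > R0 \<Longrightarrow> \<Theta> (of_real r) = of_real (heat_potential T f g b (r *\<^sub>R \<omega>))"
    using heat_potential_radial_extension[OF f supp g b b_bound \<omega>(1) R0_def] R
    unfolding \<Omega>_def R0_def by auto
  define m where "m = (R0 + R) / 2"
  have m: "R0 < m" "m < R" using R by (auto simp: m_def R0_def)
  have "open \<Omega>" unfolding \<Omega>_def by (intro open_Collect_less continuous_intros)
  have "convex \<Omega>"
    unfolding \<Omega>_def
  proof (rule convexI)
    fix z v :: complex and t1 t2 :: real
    assume zv: "z \<in> {z. Re z > R0 + \<bar>Im z\<bar>}" "v \<in> {z. Re z > R0 + \<bar>Im z\<bar>}" and t: "0 \<le> t1" "0 \<le> t2" "t1 + t2 = 1"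
    have "t1 * (R0 + \<bar>Im z\<bar>) + t2 * (R0 + \<bar>Im v\<bar>) < t1 * Re z + t2 * Re v"
      using convex_bound_lt[of "R0 + \<bar>Im z\<bar> - Re z" 0 "R0 + \<bar>Im v\<bar> - Re v" t1 t2] zv t
      by (simp add: algebra_simps)
    moreover have "t1 * R0 + t2 * R0 = R0" using t by (simp add: distrib_right[symmetric])
    moreover have "\<bar>t1 * Im z + t2 * Im v\<bar> \<le> t1 * \<bar>Im z\<bar> + t2 * \<bar>Im v\<bar>"
      using abs_triangle_ineq[of "t1 * Im z" "t2 * Im v"] t by (simp add: abs_mult)
    ultimately show "t1 *\<^sub>R z + t2 *\<^sub>R v \<in> {z. Re z > R0 + \<bar>Im z\<bar>}"
      by (simp add: distrib_left)
  qed
  have "\<Psi> (of_real r) - \<Theta> (of_real r) = 0"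
  proof (rule analytic_continuation[of "\<lambda>z. \<Psi> z - \<Theta> z" \<Omega> "of_real ` {R0<..<R}" "of_real m"])
    show "(\<lambda>z. \<Psi> z - \<Theta> z) holomorphic_on \<Omega>" by (intro holomorphic_intros \<Psi> \<Theta>)
    show "connected \<Omega>" using \<open>convex \<Omega>\<close> by (rule convex_connected)
    show "of_real ` {R0<..<R} \<subseteq> \<Omega>" "of_real m \<in> \<Omega>" "of_real r \<in> \<Omega>"
      using m r by (auto simp: \<Omega>_def)
    show "(of_real m :: complex) islimpt of_real ` {R0<..<R}"
      unfolding islimpt_approachable
    proof (intro allI impI)
      fix e :: real assume "e > 0"
      define v where "v = m + min e (R - m) / 2"
      have "v \<in> {R0<..<R}" "v \<noteq> m" "\<bar>v - m\<bar> < e" using m \<open>e > 0\<close> by (auto simp: v_def min_def field_simps)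
      then show "\<exists>x'\<in>of_real ` {R0<..<R}. x' \<noteq> (of_real m :: complex) \<and> dist x' (of_real m) < e"
        by (intro bexI[of _ "of_real v"]) (auto simp: dist_norm simp flip: of_real_diff)
    qed
    fix z :: complex assume "z \<in> of_real ` {R0<..<R}"
    then obtain t where t: "z = of_real t" "R0 < t" "t < R" by auto
    moreover have "0 \<le> R0" using R by (simp add: R0_def)
    ultimately have "t *\<^sub>R \<omega> \<in> ball 0 R" using \<omega>(1) by simp
    then show "\<Psi> z - \<Theta> z = 0" using eq \<Psi>(2) \<Theta>(2) t by simp
  qed (rule \<open>open \<Omega>\<close>)
  then show ?thesis
    using \<Psi>(2)[OF r(2)] \<Theta>(2)[OF r(2)] \<omega>(2) by simp
qed (rule eq)

section \<open>From orbit transforms to exponential moments\<close>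

lemma orbit_transform_eq_integral:
  assumes g: "continuous_on UNIV g" and a: "continuous_on UNIV a"
  shows "orbit_transform T g a p = exp (T * (norm p)\<^sup>2) *
           integral {0..T} (\<lambda>s. exp (- (norm p)\<^sup>2 * s + p \<bullet> a s) * g s)"
proof -
  define h where "h s = exp (- (norm p)\<^sup>2 * s + p \<bullet> a s) * g s" for s
  have h: "continuous_on UNIV h"
    unfolding h_def by (intro continuous_intros g a)
  have "orbit_transform T g a p = (LINT s|lborel. exp (T * (norm p)\<^sup>2) * (indicator {0..<T} s * h s))"
    unfolding orbit_transform_def h_def
    by (intro Bochner_Integration.integral_cong) (auto simp: exp_add[symmetric] algebra_simps mult_exp_exp)
  also have "\<dots> = exp (T * (norm p)\<^sup>2) * (LINT s|lborel. indicator {0..<T} s * h s)"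
    by simp
  also have "(LINT s|lborel. indicator {0..<T} s * h s) = (LINT s:{0..T}|lborel. h s)"
    unfolding set_lebesgue_integral_def
  proof (rule integral_cong_AE)
    have [measurable]: "h \<in> borel_measurable borel" using h by (rule borel_measurable_continuous_onI)
    show "(\<lambda>s. indicator {0..<T} s * h s) \<in> borel_measurable lborel"
      "(\<lambda>s. indicat_real {0..T} s *\<^sub>R h s) \<in> borel_measurable lborel" by measurable
    show "AE s in lborel. indicator {0..<T} s * h s = indicat_real {0..T} s *\<^sub>R h s"
      using AE_lborel_singleton[of T] by eventually_elim (auto simp: indicator_def)
  qed
  also have "\<dots> = integral {0..T} h"
    by (intro set_borel_integral_eq_integral borel_integrable_atLeastAtMost' continuous_on_subset[OF h]) simp
  finally show ?thesis by (simp add: h_def[abs_def])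
qed

text \<open>The transform of \<open>f\<close> can be cancelled only where it is nonzero. It is
  nonzero at some frequency by \<open>AE_zero_if_exp_moments_zero\<close>, and analyticity of the
  moments carries their agreement across its zeros.\<close>

lemma exp_moments_eq_if_transform_nonzero:
  fixes f :: "real^3 \<Rightarrow> real" and T :: real
  defines "M \<equiv> \<lambda>g a p. integral {0..T} (\<lambda>s. exp (- (norm p)\<^sup>2 * s + p \<bullet> a s) * g s)"
  assumes f: "integrable lborel f" and supp: "\<And>z. z \<notin> cball 0 \<rho> \<Longrightarrow> f z = 0"
    and nz: "\<not> (AE z in lborel. f z = 0)"
    and g: "continuous_on {0..T} g" and a: "continuous_on {0..T} a" and b: "continuous_on {0..T} b"
    and eq: "\<And>p. (LINT z|lborel. f z * exp (p \<bullet> z)) \<noteq> 0 \<Longrightarrow> M g a p = M g b p"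
  shows "M g a q = M g b q"
proof -
  (* p0 is joined to q by a line; along it the moments agree near p0, hence everywhere. *)
  obtain p0 where p0: "(LINT z|lborel. f z * exp (p0 \<bullet> z)) \<noteq> 0"
    using AE_zero_if_exp_moments_zero[OF f supp] nz by blast
  define d where "d = q - p0"
  \<comment> \<open>The transform of \<open>f\<close> along the line, with complex line parameter;
    by continuity it stays nonzero near parameter 0.\<close>
  define \<Phi> where "\<Phi> \<zeta> = (LINT z|lborel. of_real (f z * exp (p0 \<bullet> z)) * exp (\<zeta> * of_real (d \<bullet> z)))" for \<zeta> :: complex
  have [measurable]: "f \<in> borel_measurable borel" using f by simp
  have "\<Phi> holomorphic_on UNIV"
    unfolding \<Phi>_def
  proof (rule integral_holomorphic_dominated)
    show "(\<lambda>z. complex_of_real (f z * exp (p0 \<bullet> z)) * exp (\<zeta> * complex_of_real (d \<bullet> z))) \<in> borel_measurable lborel" for \<zeta>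
      by measurable
    show "(\<lambda>\<zeta>. complex_of_real (f z * exp (p0 \<bullet> z)) * exp (\<zeta> * complex_of_real (d \<bullet> z))) holomorphic_on UNIV" for z
      by (intro holomorphic_intros)
    fix \<zeta> :: complex
    \<comment> \<open>A majorant valid for all parameters v within distance 1 of
      \<open>\<zeta>\<close>, since then |v| \<le> |\<zeta>| + 1.\<close>
    define E where "E z = \<bar>f z\<bar> * exp (p0 \<bullet> z + (norm \<zeta> + 1) * (norm d * norm z))" for z
    have "integrable lborel E"
      unfolding E_def
      by (intro integrable_mult_continuous_if_bounded_support[where \<rho>=\<rho>] integrable_abs f continuous_intros)
        (simp add: supp)
    moreover have "norm (complex_of_real (f z * exp (p0 \<bullet> z)) * exp (v * complex_of_real (d \<bullet> z))) \<le> E z"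
      if "v \<in> cball \<zeta> 1" for v z
    proof -
      have "norm v \<le> norm \<zeta> + 1"
        using that norm_triangle_ineq2[of v \<zeta>] by (simp add: dist_norm norm_minus_commute)
      have "Re v * (d \<bullet> z) \<le> \<bar>Re v\<bar> * \<bar>d \<bullet> z\<bar>" by (metis abs_ge_self abs_mult)
      also have "\<dots> \<le> (norm \<zeta> + 1) * (norm d * norm z)"
        using \<open>norm v \<le> norm \<zeta> + 1\<close> abs_Re_le_cmod[of v] Cauchy_Schwarz_ineq2[of d z]
        by (intro mult_mono) auto
      finally have "exp (Re v * (d \<bullet> z)) \<le> exp ((norm \<zeta> + 1) * (norm d * norm z))" by simp
      then have "\<bar>f z\<bar> * exp (p0 \<bullet> z) * exp (Re v * (d \<bullet> z)) \<le> \<bar>f z\<bar> * exp (p0 \<bullet> z) * exp ((norm \<zeta> + 1) * (norm d * norm z))"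
        by (intro mult_left_mono) auto
      then show ?thesis by (simp add: E_def exp_add norm_mult abs_mult mult.assoc)
    qed
    ultimately show "\<exists>r>0. \<exists>B. integrable lborel B \<and> cball \<zeta> r \<subseteq> UNIV \<and>
        (\<forall>w\<in>cball \<zeta> r. \<forall>z\<in>space lborel. norm (complex_of_real (f z * exp (p0 \<bullet> z)) * exp (w * complex_of_real (d \<bullet> z))) \<le> B z)"
      by (intro exI[of _ 1] conjI exI[of _ E]) auto
  qed
  then have "isCont \<Phi> 0"
    using holomorphic_on_imp_continuous_on[of \<Phi> UNIV] by (auto simp: continuous_on_eq_continuous_at)
  have \<Phi>_real: "\<Phi> (of_real t) = of_real (LINT z|lborel. f z * exp ((p0 + t *\<^sub>R d) \<bullet> z))" for t
  proof -
    have "\<Phi> (of_real t) = (LINT z|lborel. complex_of_real (f z * exp ((p0 + t *\<^sub>R d) \<bullet> z)))"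
      unfolding \<Phi>_def by (intro Bochner_Integration.integral_cong)
        (auto simp: inner_add_left exp_add exp_of_real[symmetric])
    then show ?thesis by (simp only: integral_complex_of_real)
  qed
  have "\<Phi> 0 \<noteq> 0" using \<Phi>_real[of 0] p0 by simp
  with \<open>isCont \<Phi> 0\<close> obtain \<delta> where \<delta>: "\<delta> > 0" "\<And>\<zeta>. dist \<zeta> 0 < \<delta> \<Longrightarrow> \<Phi> \<zeta> \<noteq> 0"
    using continuous_at_avoid[of 0 \<Phi> 0] by (auto simp: dist_commute)
  \<comment> \<open>The moment at p0 + \<zeta> d, sorted by powers of \<open>\<zeta>\<close> after
    expanding |p0 + \<zeta> d|^2 as |p0|^2 + 2 \<zeta> (p0 . d) + \<zeta>^2 |d|^2.\<close>
  define \<Psi> where "\<Psi> c \<zeta> = integral {0..T} (\<lambda>s. exp (\<zeta>\<^sup>2 * of_real (- (norm d)\<^sup>2 * s)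
      + \<zeta> * of_real (- 2 * (p0 \<bullet> d) * s + d \<bullet> c s)) * of_real (exp (- (norm p0)\<^sup>2 * s + p0 \<bullet> c s) * g s))"
    for c and \<zeta> :: complex
  have hol: "\<Psi> c holomorphic_on UNIV" if "continuous_on {0..T} c" for c
    unfolding \<Psi>_def
    by (intro exp_quadratic_integral_holomorphic continuous_intros that g)
  have \<Psi>_real: "\<Psi> c (of_real t) = of_real (M g c (p0 + t *\<^sub>R d))" if c: "continuous_on {0..T} c" for c t
  proof -
    have "(\<lambda>s. exp (- (norm (p0 + t *\<^sub>R d))\<^sup>2 * s + (p0 + t *\<^sub>R d) \<bullet> c s) * g s) integrable_on {0..T}"
      by (intro integrable_continuous_interval continuous_intros c g)
    then have "((\<lambda>s. complex_of_real (exp (- (norm (p0 + t *\<^sub>R d))\<^sup>2 * s + (p0 + t *\<^sub>R d) \<bullet> c s) * g s))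
        has_integral of_real (M g c (p0 + t *\<^sub>R d))) {0..T}"
      unfolding M_def by (intro has_integral_of_real integrable_integral)
    moreover have "complex_of_real (exp (- (norm (p0 + t *\<^sub>R d))\<^sup>2 * s + (p0 + t *\<^sub>R d) \<bullet> c s) * g s)
        = exp ((of_real t)\<^sup>2 * of_real (- (norm d)\<^sup>2 * s)
          + of_real t * of_real (- 2 * (p0 \<bullet> d) * s + d \<bullet> c s)) * of_real (exp (- (norm p0)\<^sup>2 * s + p0 \<bullet> c s) * g s)" for s
    proof -
      have "- (norm (p0 + t *\<^sub>R d))\<^sup>2 * s + (p0 + t *\<^sub>R d) \<bullet> c s
          = (t\<^sup>2 * (- (norm d)\<^sup>2 * s) + t * (- 2 * (p0 \<bullet> d) * s + d \<bullet> c s)) + (- (norm p0)\<^sup>2 * s + p0 \<bullet> c s)"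
        unfolding power2_norm_eq_inner
        by (simp add: inner_add_left inner_add_right inner_commute power2_eq_square algebra_simps)
      then have "exp (- (norm (p0 + t *\<^sub>R d))\<^sup>2 * s + (p0 + t *\<^sub>R d) \<bullet> c s)
          = exp (t\<^sup>2 * (- (norm d)\<^sup>2 * s) + t * (- 2 * (p0 \<bullet> d) * s + d \<bullet> c s)) * exp (- (norm p0)\<^sup>2 * s + p0 \<bullet> c s)"
        by (simp only: exp_add)
      then show ?thesis
        by (simp only: of_real_mult exp_of_real[symmetric] of_real_add of_real_power mult.assoc)
    qed
    ultimately show ?thesis
      unfolding \<Psi>_def by (intro integral_unique) (simp only:)
  qed
  \<comment> \<open>At parameter 1 the line reaches \<open>q\<close>.\<close>
  have "\<Psi> a 1 = \<Psi> b 1"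
  proof (rule entire_eq_on_reals[OF hol[OF a] hol[OF b] \<delta>(1)])
    fix t :: real assume "\<bar>t\<bar> < \<delta>"
    then have "\<Phi> (of_real t) \<noteq> 0" by (intro \<delta>) simp
    then have "M g a (p0 + t *\<^sub>R d) = M g b (p0 + t *\<^sub>R d)"
      unfolding \<Phi>_real by (intro eq) simp
    then show "\<Psi> a (of_real t) = \<Psi> b (of_real t)" by (simp only: \<Psi>_real a b)
  qed
  then show ?thesis
    using \<Psi>_real[OF a, of 1] \<Psi>_real[OF b, of 1] by (simp add: d_def)
qed

section \<open>Duhamel's formula as a heat potential, and Lipschitz bounds for orbits\<close>

lemma AE_lborel_translate:
  fixes c :: "'a::euclidean_space"
  assumes "AE z in lborel. P z"
  shows "AE y in lborel. P (y - c)"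
proof -
  have "AE z in distr lborel borel ((+) (- c)). P z"
    unfolding lborel_distr_plus by (rule assms)
  then have "AE y in lborel. P (- c + y)"
    by (rule AE_distrD[rotated]) simp
  then show ?thesis by simp
qed

text \<open>Translation invariance gives the substitution y = a(s) + z. Altering \<open>f\<close> on
  a null set, and \<open>g\<close> and \<open>a\<close> outside [0, T], does not affect the
  integrals, so a Borel profile and continuous data on the whole line may be used instead.\<close>

lemma duhamel_moving_source:
  fixes f f0 :: "real^3 \<Rightarrow> real"
  assumes f: "AE z in lborel. f z = f0 z" and f0: "f0 \<in> borel_measurable borel"
    and g': "continuous_on UNIV g'" "\<And>s. s \<in> {0..T} \<Longrightarrow> g' s = g s"
    and a': "continuous_on UNIV a'" "\<And>s. s \<in> {0..T} \<Longrightarrow> a' s = a s"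
  shows "duhamel (moving_source f g a) x T = heat_potential T f0 g' a' x"
proof -
  have [measurable]: "f0 \<in> borel_measurable borel" "g' \<in> borel_measurable borel" "a' \<in> borel_measurable borel"
    using f0 g' a' by (auto intro: borel_measurable_continuous_onI)
  define I where "I s = (LINT z|lborel. g' s * f0 z * heat_kernel (x - (a' s + z)) (T - s))" for s
  have [measurable]: "I \<in> borel_measurable borel" unfolding I_def by measurable
  have inner: "(LINT y|lebesgue. heat_kernel (x - y) (T - s) * (f (y - a s) * g s)) = I s"
    if s: "s \<in> {0..T}" for s
  proof -
    have ae: "AE y in lebesgue. f (y - a s) = f0 (y - a s)"
      using f by (intro AE_completion AE_lborel_translate)
    have k: "(\<lambda>y. heat_kernel (x - y) (T - s) * (f0 (y - a s) * g s)) \<in> borel_measurable borel"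
      by measurable
    have "(LINT y|lebesgue. heat_kernel (x - y) (T - s) * (f (y - a s) * g s))
        = (LINT y|lebesgue. heat_kernel (x - y) (T - s) * (f0 (y - a s) * g s))"
    proof (rule integral_cong_AE)
      show k': "(\<lambda>y. heat_kernel (x - y) (T - s) * (f0 (y - a s) * g s)) \<in> borel_measurable lebesgue"
        using k by (intro measurable_completion) simp
      show "(\<lambda>y. heat_kernel (x - y) (T - s) * (f (y - a s) * g s)) \<in> borel_measurable lebesgue"
        by (rule borel_measurable_AE[OF k']) (use ae in eventually_elim, simp)
    qed (use ae in eventually_elim, simp)
    also have "\<dots> = (LINT y|lborel. heat_kernel (x - y) (T - s) * (f0 (y - a s) * g s))"
      using k by (intro integral_completion) simp
    also have "\<dots> = (LINT y|distr lborel borel ((+) (a s)). heat_kernel (x - y) (T - s) * (f0 (y - a s) * g s))"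
      by (simp only: lborel_distr_plus)
    also have "\<dots> = (LINT z|lborel. heat_kernel (x - (a s + z)) (T - s) * (f0 (a s + z - a s) * g s))"
      using k by (intro integral_distr) simp_all
    also have "\<dots> = I s"
      using s by (simp add: I_def g' a' mult_ac)
    finally show ?thesis .
  qed
  have "duhamel (moving_source f g a) x T = (LINT s|lebesgue_on {0..T}. I s)"
    unfolding duhamel_def moving_source_def
    by (intro Bochner_Integration.integral_cong) (auto simp: inner)
  also have "\<dots> = (LINT s|lebesgue. indicator {0..T} s *\<^sub>R I s)"
    by (intro integral_restrict_space) simp
  also have "\<dots> = (LINT s|lborel. indicator {0..T} s *\<^sub>R I s)"
    by (intro integral_completion) simp
  also have "\<dots> = (LINT s|lborel. indicator {0..<T} s * I s)"
  proof (rule integral_cong_AE)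
    show "AE s in lborel. indicat_real {0..T} s *\<^sub>R I s = indicator {0..<T} s * I s"
      using AE_lborel_singleton[of T] by eventually_elim (auto simp: indicator_def)
  qed simp_all
  also have "\<dots> = heat_potential T f0 g' a' x"
    by (simp add: heat_potential_def I_def mult.assoc)
  finally show ?thesis .
qed

lemma C1_curve_lipschitz:
  fixes a a' :: "real \<Rightarrow> 'a::real_normed_vector"
  assumes deriv: "\<And>t. t \<ge> 0 \<Longrightarrow> (a has_vector_derivative a' t) (at t within {0..})"
    and cont: "continuous_on {0..} a'"
  obtains L where "L > 0" "\<And>s t. s \<in> {0..T} \<Longrightarrow> t \<in> {0..T} \<Longrightarrow> norm (a s - a t) \<le> L * \<bar>s - t\<bar>"
proof -
  have "compact (a' ` {0..T})"
    by (intro compact_continuous_image continuous_on_subset[OF cont]) auto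
  then obtain L where L: "L > 0" "\<And>t. t \<in> {0..T} \<Longrightarrow> norm (a' t) \<le> L"
    using compact_imp_bounded bounded_pos[of "a' ` {0..T}"] by auto
  have "norm (a s - a t) \<le> L * norm (s - t)" if "s \<in> {0..T}" "t \<in> {0..T}" for s t
  proof (rule differentiable_bound[where S="{0..T}" and f'="\<lambda>t h. h *\<^sub>R a' t"])
    show "(a has_derivative (\<lambda>h. h *\<^sub>R a' r)) (at r within {0..T})" if "r \<in> {0..T}" for r
      using deriv[of r] that unfolding has_vector_derivative_def
      by (auto intro: has_derivative_subset)
    show "onorm (\<lambda>h. h *\<^sub>R a' r) \<le> L" if "r \<in> {0..T}" for r
      using L(2)[OF that] by (intro onorm_le) (simp add: mult.commute[of L] mult_left_mono)
  qed (use that in auto)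
  then show ?thesis using L(1) that by simp
qed

section \<open>Uniqueness of the orbit\<close>

theorem theorem3p2:
  fixes R1 R2 R T :: real
    and f :: "real^3 \<Rightarrow> real"
    and g :: "real \<Rightarrow> real"
    and a b a' b' :: "real \<Rightarrow> real^3"
    and u1 u2 :: "real^3 \<Rightarrow> real \<Rightarrow> real"
  assumes "R1 > 0" and "R2 > 0" and "R > R1 + R2" and "T > 0"
    and f_L2: "f square_integrable_on ball 0 R"
    and f_nonzero: "\<not> (AE x in lebesgue_on (ball 0 R). f x = 0)"
    and f_supp: "\<exists>K. compact K \<and> K \<subseteq> ball 0 R1 \<and>
                  (AE x in lebesgue_on (ball 0 R). x \<notin> K \<longrightarrow> f x = 0)"
    and f_ext: "\<And>x. x \<notin> ball 0 R \<Longrightarrow> f x = 0"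
    and g_cont: "continuous_on {0..} g"
    and g_bounded: "bounded (g ` {0..})"
    and g_pos: "\<And>t. t \<in> {0<..<T} \<Longrightarrow> g t > 0"
    and a_deriv: "\<And>t. t \<ge> 0 \<Longrightarrow> (a has_vector_derivative a' t) (at t within {0..})"
    and a'_cont: "continuous_on {0..} a'"
    and b_deriv: "\<And>t. t \<ge> 0 \<Longrightarrow> (b has_vector_derivative b' t) (at t within {0..})"
    and b'_cont: "continuous_on {0..} b'"
    and a_bound: "\<And>t. t \<ge> 0 \<Longrightarrow> norm (a t) < R2"
    and b_bound: "\<And>t. t \<ge> 0 \<Longrightarrow> norm (b t) < R2"
    and "a 0 = 0" and "b 0 = 0"
    and a'_nonzero: "\<And>j t. t \<in> {0<..<T} \<Longrightarrow> a' t $ j \<noteq> 0"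
    and b'_nonzero: "\<And>j t. t \<in> {0<..<T} \<Longrightarrow> b' t $ j \<noteq> 0"
    and u1_sol: "heat_solution (moving_source f g a) u1"
    and u2_sol: "heat_solution (moving_source f g b) u2"
    and u1_values: "\<And>x t. t \<ge> 0 \<Longrightarrow> u1 x t = duhamel (moving_source f g a) x t"
    and u2_values: "\<And>x t. t \<ge> 0 \<Longrightarrow> u2 x t = duhamel (moving_source f g b) x t"
    and data: "\<And>x. x \<in> ball 0 R \<Longrightarrow> u1 x T = u2 x T"
  shows "\<forall>t\<in>{0..T}. a t = b t"
proof -
  from f_supp obtain K where K: "compact K" "K \<subseteq> ball 0 R1"
    and f_K: "AE x in lebesgue_on (ball 0 R). x \<notin> K \<longrightarrow> f x = 0" by blast
  have f_meas: "f \<in> borel_measurable (lebesgue_on (ball 0 R))"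
    and f_sq: "integrable (lebesgue_on (ball 0 R)) (\<lambda>x. (f x)\<^sup>2)"
    using f_L2 by (auto simp: square_integrable_on_def)
  have f_if: "(\<lambda>x. if x \<in> ball 0 R then f x else 0) = f" using f_ext by auto
  \<comment> \<open>The ball has finite measure, so square integrability gives
    integrability.\<close>
  interpret fin: finite_measure "lebesgue_on (ball 0 R :: (real^3) set)"
    by (rule finite_measure_lebesgue_on) simp
  have "integrable (lebesgue_on (ball 0 R)) f"
    by (rule fin.square_integrable_imp_integrable[OF f_meas f_sq])
  then have int_f: "integrable lebesgue f"
    using Lebesgue_Measure.integrable_restrict_UNIV[of "ball 0 R" f] unfolding f_if by simp
  obtain f1 where f1: "f1 \<in> borel_measurable lborel" "AE x in lborel. f x = f1 x"
    using completion_ex_borel_measurable_real[OF borel_measurable_integrable[OF int_f]] by blast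
  \<comment> \<open>Cutting off outside \<open>K\<close> makes the support condition hold at every
    point; \<open>f1\<close> changes only on a null set.\<close>
  define f0 where "f0 x = (if x \<in> K then f1 x else 0)" for x
  have K_borel [measurable]: "K \<in> sets borel" using K(1) by (simp add: compact_imp_closed)
  have f0_meas [measurable]: "f0 \<in> borel_measurable borel"
    using f1(1) unfolding f0_def by simp
  have "AE x in lebesgue. x \<in> ball 0 R \<longrightarrow> x \<notin> K \<longrightarrow> f x = 0"
    using f_K by (subst (asm) AE_restrict_space_iff) auto
  then have "AE x in lborel. x \<in> ball 0 R \<longrightarrow> x \<notin> K \<longrightarrow> f x = 0"
    by (simp only: AE_completion_iff)
  with f1(2) have f_f0: "AE x in lborel. f x = f0 x"
    by eventually_elim (auto simp: f0_def f_ext)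
  have "integrable lebesgue f0"
  proof (rule integrable_cong_AE_imp[OF int_f])
    show "f0 \<in> borel_measurable lebesgue" by (intro measurable_completion) simp
    show "AE x in lebesgue. f x = f0 x" using f_f0 by (rule AE_completion)
  qed
  then have int_f0: "integrable lborel f0" by (simp add: integrable_completion)
  have supp_f0: "f0 z = 0" if "z \<notin> cball 0 R1" for z
    using that K(2) by (auto simp: f0_def)
  have f0_nz: "\<not> (AE z in lborel. f0 z = 0)"
  proof
    assume "AE z in lborel. f0 z = 0"
    with f_f0 have "AE z in lborel. f z = 0" by eventually_elim simp
    then have "AE z in lebesgue. f z = 0" by (rule AE_completion)
    then have "AE z in lebesgue_on (ball 0 R). f z = 0"
      by (subst AE_restrict_space_iff) auto
    with f_nonzero show False by contradiction
  qed

  \<comment> \<open>Freezing the data at time 0 for negative times gives continuous functions on the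
    whole line with the same values on [0, T].\<close>
  define g\<^sub>0 where "g\<^sub>0 s = g (max 0 s)" for s
  define a\<^sub>0 where "a\<^sub>0 s = a (max 0 s)" for s
  define b\<^sub>0 where "b\<^sub>0 s = b (max 0 s)" for s
  have cont_a: "continuous_on {0..} a" and cont_b: "continuous_on {0..} b"
    using has_vector_derivative_continuous[OF a_deriv] has_vector_derivative_continuous[OF b_deriv]
    by (auto simp: continuous_on_eq_continuous_within)
  have ext: "continuous_on UNIV (\<lambda>s. c (max 0 s))" if "continuous_on {0..} c"
    for c :: "real \<Rightarrow> 'x::topological_space"
    by (rule continuous_on_compose2[OF that]) (auto intro!: continuous_intros)
  have cont: "continuous_on UNIV g\<^sub>0" "continuous_on UNIV a\<^sub>0" "continuous_on UNIV b\<^sub>0"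
    using ext[OF g_cont] ext[OF cont_a] ext[OF cont_b] by (simp_all add: g\<^sub>0_def a\<^sub>0_def b\<^sub>0_def)
  have duh: "duhamel (moving_source f g a) x T = heat_potential T f0 g\<^sub>0 a\<^sub>0 x"
    "duhamel (moving_source f g b) x T = heat_potential T f0 g\<^sub>0 b\<^sub>0 x" for x
    using f_f0 cont by (auto intro!: duhamel_moving_source simp: g\<^sub>0_def a\<^sub>0_def b\<^sub>0_def)
  have pot_ball: "heat_potential T f0 g\<^sub>0 a\<^sub>0 x = heat_potential T f0 g\<^sub>0 b\<^sub>0 x" if "x \<in> ball 0 R" for x
    using data[OF that] u1_values[of T x] u2_values[of T x] \<open>T > 0\<close> by (simp add: duh)
  have bounds: "norm (a\<^sub>0 s) \<le> R2" "norm (b\<^sub>0 s) \<le> R2" for s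
    using a_bound[of "max 0 s"] b_bound[of "max 0 s"] by (simp_all add: a\<^sub>0_def b\<^sub>0_def)
  have pot_eq: "heat_potential T f0 g\<^sub>0 a\<^sub>0 x = heat_potential T f0 g\<^sub>0 b\<^sub>0 x" for x
    by (rule heat_potential_eq_everywhere[OF int_f0 supp_f0 cont bounds \<open>R > R1 + R2\<close> _ _ pot_ball])
      (use \<open>R1 > 0\<close> \<open>R2 > 0\<close> in auto)
  have trans: "(LINT z|lborel. f0 z * exp (p \<bullet> z)) * orbit_transform T g\<^sub>0 a\<^sub>0 p
      = (LINT z|lborel. f0 z * exp (p \<bullet> z)) * orbit_transform T g\<^sub>0 b\<^sub>0 p" for p
    using heat_potential_exp_transform[OF int_f0 supp_f0 cont(1,2), where p=p and T=T]
      heat_potential_exp_transform[OF int_f0 supp_f0 cont(1,3), where p=p and T=T] by (simp add: pot_eq)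
  have moments: "integral {0..T} (\<lambda>s. exp (- (norm q)\<^sup>2 * s + q \<bullet> a\<^sub>0 s) * g\<^sub>0 s)
      = integral {0..T} (\<lambda>s. exp (- (norm q)\<^sup>2 * s + q \<bullet> b\<^sub>0 s) * g\<^sub>0 s)" for q
  proof (rule exp_moments_eq_if_transform_nonzero[OF int_f0 supp_f0 f0_nz])
    fix p assume "(LINT z|lborel. f0 z * exp (p \<bullet> z)) \<noteq> 0"
    then have "orbit_transform T g\<^sub>0 a\<^sub>0 p = orbit_transform T g\<^sub>0 b\<^sub>0 p"
      using trans[of p] by simp
    then show "integral {0..T} (\<lambda>s. exp (- (norm p)\<^sup>2 * s + p \<bullet> a\<^sub>0 s) * g\<^sub>0 s)
      = integral {0..T} (\<lambda>s. exp (- (norm p)\<^sup>2 * s + p \<bullet> b\<^sub>0 s) * g\<^sub>0 s)"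
      using cont by (simp add: orbit_transform_eq_integral)
  qed (use cont in \<open>auto intro: continuous_on_subset\<close>)

  obtain La where La: "La > 0" "\<And>s t. s \<in> {0..T} \<Longrightarrow> t \<in> {0..T} \<Longrightarrow> norm (a s - a t) \<le> La * \<bar>s - t\<bar>"
    using C1_curve_lipschitz[OF a_deriv a'_cont] by blast
  obtain Lb where Lb: "Lb > 0" "\<And>s t. s \<in> {0..T} \<Longrightarrow> t \<in> {0..T} \<Longrightarrow> norm (b s - b t) \<le> Lb * \<bar>s - t\<bar>"
    using C1_curve_lipschitz[OF b_deriv b'_cont] by blast
  define L where "L = La + Lb"
  have L: "L > 0" using La Lb by (simp add: L_def)
  have lip: "\<bar>c s $ j - c t $ j\<bar> \<le> L * \<bar>s - t\<bar>"
    if "c = a \<or> c = b" "s \<in> {0..T}" "t \<in> {0..T}" for c :: "real \<Rightarrow> real^3" and s t j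
  proof -
    have "\<bar>c s $ j - c t $ j\<bar> \<le> norm (c s - c t)"
      using component_le_norm_cart[of "c s - c t" j] by simp
    also have "\<dots> \<le> L * \<bar>s - t\<bar>"
      using that La(2)[OF that(2,3)] Lb(2)[OF that(2,3)]
        mult_right_mono[of La L "\<bar>s - t\<bar>"] mult_right_mono[of Lb L "\<bar>s - t\<bar>"] La(1) Lb(1)
      unfolding L_def by auto
    finally show ?thesis .
  qed
  \<comment> \<open>A frequency on the j-th axis sees only the j-th component of the orbit, which
    makes the problem one-dimensional.\<close>
  have comp: "integral {0..T} (\<lambda>s. exp (- r\<^sup>2 * s + r * (a s $ j)) * g s)
      = integral {0..T} (\<lambda>s. exp (- r\<^sup>2 * s + r * (b s $ j)) * g s)" for r j
  proof -
    have "(norm (axis j r :: real^3))\<^sup>2 = r\<^sup>2"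
      by (simp only: power2_norm_eq_inner inner_axis_axis) (simp add: power2_eq_square)
    then have "integral {0..T} (\<lambda>s. exp (- r\<^sup>2 * s + r * (c s $ j)) * g s)
      = integral {0..T} (\<lambda>s. exp (- (norm (axis j r))\<^sup>2 * s + axis j r \<bullet> c (max 0 s)) * g\<^sub>0 s)" for c :: "real \<Rightarrow> real^3"
      by (intro Henstock_Kurzweil_Integration.integral_cong) (auto simp: g\<^sub>0_def inner_axis')
    then show ?thesis
      using moments[of "axis j r"] by (simp add: a\<^sub>0_def b\<^sub>0_def)
  qed
  have g_T: "continuous_on {0..T} g" using g_cont by (rule continuous_on_subset) auto
  have start: "a 0 $ j = b 0 $ j" for j using \<open>a 0 = 0\<close> \<open>b 0 = 0\<close> by simp
  show ?thesis
  proof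
    fix t assume t: "t \<in> {0..T}"
    have "a t $ j \<le> b t $ j" for j
      by (rule orbit_unique_of_exp_moments[OF \<open>T > 0\<close> g_T g_pos lip lip L start comp t]) auto
    moreover have "b t $ j \<le> a t $ j" for j
      by (rule orbit_unique_of_exp_moments[OF \<open>T > 0\<close> g_T g_pos lip lip L start[symmetric] comp[symmetric] t]) auto
    ultimately show "a t = b t" by (simp add: vec_eq_iff order_antisym)
  qed
qed

end
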